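(* Let $\mathbb{K}$ be a field of arbitrary characteristic and let $\mathcal{C}$ be an affine line arrangement in $V=\mathbb{K}^2$ with $\chi(\mathcal{C},t)=(t-a)(t-a-b)$, where $a,b\in\mathbb{C}$ and $|a|\le|a+b|$. For a line $H$ in $V$ put $n_H=|\mathcal{C}\cap H|$. Then: (1) There is no $H\in\mathcal{C}$ such that $|a|<|\mathcal{C}\cap H|<|a+b|$. In other words, $\chi(\mathcal{C},n_H)\ge 0$ for every $H\in\mathcal{C}$. (2) There is no line $L\notin\mathcal{C}$ such that $|a|<|\mathcal{C}\cap L|<|a+b|$. In other words, $\chi(\mathcal{C},n_L)\ge 0$ for every line $L\notin\mathcal{C}$. (3) Assume that $a,b\in\mathbb{Z}_{\ge 0}$. Then $\mathcal{C}$ is free if there is a line $H$ in $V$ (in $\mathcal{C}$ or not) such that $|\mathcal{C}\cap H|=a$ or $|\mathcal{C}\cap H|=a+b$. Equivalently, $\mathcal{C}$ is free if $\chi(\mathcal{C},n_H)=0$ for some line $H$.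
   Context: An affine line arrangement $\mathcal{C}$ in $V=\mathbb{K}^2$ is a finite set of affine lines in $V$. $L(\mathcal{C})$ is the set of all nonempty intersections of subsets of $\mathcal{C}$ (including $V$, the empty intersection). Define $\mu(V)=1$ and $\mu(X)=-\sum_{Y\in L(\mathcal{C}),\,X\subsetneq Y\subset V}\mu(Y)$; the characteristic polynomial is $\chi(\mathcal{C},t)=\sum_{X\in L(\mathcal{C})}\mu(X)t^{\dim X}$. For any line $H$ in $V$ (in $\mathcal{C}$ or not), $\mathcal{C}\cap H:=\{H\cap H'\mid H'\in\mathcal{C},\ H'\ne H,\ H\cap H'\neq\emptyset\}$ is the set of intersection points on $H$, and $n_H:=|\mathcal{C}\cap H|$. Freeness: let $S=\mathbb{K}[x,y,z]$. The cone $c\mathcal{C}$ is the central arrangement in $\mathbb{K}^3$ consisting of the plane $z=0$ and the planes $cH=\{\alpha_{cH}=0\}$, $H\in\mathcal{C}$, where $\alpha_{cH}$ is the homogenization by $z$ of a degree one polynomial defining $H$. Let $D(c\mathcal{C})=\{\theta\in\mathrm{Der}\,S\mid \theta(\alpha_{cH})\in S\alpha_{cH}\ (\forall H\in\mathcal{C}),\ \theta(z)\in Sz\}$, where $\mathrm{Der}\,S$ is the module of $\mathbb{K}$-derivations of $S$. $\mathcal{C}$ is free with exponents $\exp_0(\mathcal{C})=(d_1,d_2)$ if $D(c\mathcal{C})$ is a free $S$-module with a homogeneous basis $\theta_E=x\partial_x+y\partial_y+z\partial_z,\theta_1,\theta_2$ with $\deg\theta_i=d_i$ (the degree of a homogeneous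 derivation is the polynomial degree of its coefficients). *)

theory Defs
  imports
    "HOL-Analysis.Cartesian_Space"
    "HOL-Library.Function_Algebras"
    "HOL-Computational_Algebra.Polynomial"
begin

section \<open>Affine line arrangements in the plane and their characteristic polynomial\<close>

definition line_zero_set :: "'k::field \<Rightarrow> 'k \<Rightarrow> 'k \<Rightarrow> ('k ^ 2) set" where
  "line_zero_set a b c = {v. a * v $ 1 + b * v $ 2 + c = 0}"

definition affine_lines :: "('k::field ^ 2) set set" where
  "affine_lines = {line_zero_set a b c | a b c. a \<noteq> 0 \<or> b \<noteq> 0}"

definition line_arrangement :: "('k::field ^ 2) set set \<Rightarrow> bool" where
  "line_arrangement C \<longleftrightarrow> finite C \<and> C \<subseteq> affine_lines"

text \<open>The case \<open>B = {}\<close> contributes \<open>\<Inter> {} = UNIV\<close>, the whole plane.\<close>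

definition intersection_poset :: "'v set set \<Rightarrow> 'v set set" where
  "intersection_poset C = {\<Inter> B | B. B \<subseteq> C \<and> \<Inter> B \<noteq> {}}"

text \<open>The guard \<open>finite C\<close> only serves to make the recursion terminate.\<close>

function moebius :: "'v set set \<Rightarrow> 'v set \<Rightarrow> int" where
  "moebius C X =
     (if X = UNIV then 1
      else if finite C then - (\<Sum>Y \<in> {Y \<in> intersection_poset C. X \<subset> Y}. moebius C Y)
      else 0)"
  by auto
termination
proof (relation "measure (\<lambda>(C, X). card {Y \<in> intersection_poset C. X \<subset> Y})")
  fix C :: "'v set set" and X Y
  assume "finite C" and Y: "Y \<in> {Y \<in> intersection_poset C. X \<subset> Y}"
  have "intersection_poset C \<subseteq> \<Inter> ` Pow C"
    unfolding intersection_poset_def by auto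
  with \<open>finite C\<close> have "finite (intersection_poset C)"
    by (meson finite_Pow_iff finite_imageI finite_subset)
  then have "card {Z \<in> intersection_poset C. Y \<subset> Z} < card {Z \<in> intersection_poset C. X \<subset> Z}"
    using Y by (intro psubset_card_mono) auto
  then show "((C, Y), (C, X)) \<in> measure (\<lambda>(C, X). card {Y \<in> intersection_poset C. X \<subset> Y})"
    by simp
qed simp

declare moebius.simps [simp del]

text \<open>The dimension of an affine subspace is that of its space of directions.\<close>

definition affine_subspace_dim :: "('k::field ^ 2) set \<Rightarrow> nat" where
  "affine_subspace_dim X = vec.dim {u - v | u v. u \<in> X \<and> v \<in> X}"

definition characteristic_poly :: "('k::field ^ 2) set set \<Rightarrow> int poly" where
  "characteristic_poly C =
     (\<Sum>X \<in> intersection_poset C. monom (moebius C X) (affine_subspace_dim X))"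

text \<open>The points of \<open>C\<close> on \<open>H\<close> are kept as the subsets \<open>H \<inter> H'\<close> of the plane; they are singletons
  when \<open>H\<close> and \<open>H'\<close> are distinct lines.\<close>

definition points_on_line :: "'v set set \<Rightarrow> 'v set \<Rightarrow> 'v set set" where
  "points_on_line C H = {H \<inter> H' | H'. H' \<in> C \<and> H' \<noteq> H \<and> H \<inter> H' \<noteq> {}}"

abbreviation num_points_on_line :: "'v set set \<Rightarrow> 'v set \<Rightarrow> nat" where
  "num_points_on_line C H \<equiv> card (points_on_line C H)"


section \<open>The polynomial ring in three variables and its derivations\<close>

text \<open>\<open>K[x,y,z]\<close> is rendered as \<open>K[x][y][z]\<close>: the coefficient of \<open>x\<^sup>i y\<^sup>j z\<^sup>k\<close> in \<open>p\<close> is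
  \<open>coeff (coeff (coeff p k) j) i\<close>.\<close>

type_synonym 'k poly3 = "'k poly poly poly"

definition const3 :: "'k::field \<Rightarrow> 'k poly3" where
  "const3 c = [:[:[:c:]:]:]"

definition var_x :: "'k::field poly3" where
  "var_x = [:[:[:0, 1:]:]:]"

definition var_y :: "'k::field poly3" where
  "var_y = [:[:0, 1:]:]"

definition var_z :: "'k::field poly3" where
  "var_z = [:0, 1:]"

definition homogeneous3 :: "nat \<Rightarrow> 'k::field poly3 \<Rightarrow> bool" where
  "homogeneous3 d p \<longleftrightarrow> (\<forall>i j k. coeff (coeff (coeff p k) j) i \<noteq> 0 \<longrightarrow> i + j + k = d)"

definition partial_x :: "'k::field poly3 \<Rightarrow> 'k poly3" where
  "partial_x = map_poly (map_poly pderiv)"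

definition partial_y :: "'k::field poly3 \<Rightarrow> 'k poly3" where
  "partial_y = map_poly pderiv"

definition partial_z :: "'k::field poly3 \<Rightarrow> 'k poly3" where
  "partial_z = pderiv"

definition derivations :: "('k::field poly3 \<Rightarrow> 'k poly3) set" where
  "derivations = {\<theta>. (\<forall>p q. \<theta> (p + q) = \<theta> p + \<theta> q) \<and>
                      (\<forall>c p. \<theta> (const3 c * p) = const3 c * \<theta> p) \<and>
                      (\<forall>p q. \<theta> (p * q) = \<theta> p * q + p * \<theta> q)}"

text \<open>Maps \<open>S \<Rightarrow> S\<close> form an \<open>S\<close>-module under pointwise operations, containing \<open>derivations\<close>.\<close>

definition der_scale :: "'k::field poly3 \<Rightarrow> ('k poly3 \<Rightarrow> 'k poly3) \<Rightarrow> ('k poly3 \<Rightarrow> 'k poly3)" where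
  "der_scale f \<theta> = (\<lambda>p. f * \<theta> p)"

interpretation der: module der_scale
  by unfold_locales (auto simp: der_scale_def fun_eq_iff algebra_simps)

definition euler_derivation :: "'k::field poly3 \<Rightarrow> 'k poly3" where
  "euler_derivation =
     der_scale var_x partial_x + der_scale var_y partial_y + der_scale var_z partial_z"

text \<open>The coefficients of \<open>\<theta>\<close> with respect to the partial derivatives are its values on the
  variables.\<close>

definition homogeneous_derivation :: "nat \<Rightarrow> ('k::field poly3 \<Rightarrow> 'k poly3) \<Rightarrow> bool" where
  "homogeneous_derivation d \<theta> \<longleftrightarrow> \<theta> \<in> derivations \<and>
     homogeneous3 d (\<theta> var_x) \<and> homogeneous3 d (\<theta> var_y) \<and> homogeneous3 d (\<theta> var_z)"


section \<open>Freeness\<close>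

text \<open>The homogenization by \<open>z\<close> of the polynomial \<open>a x + b y + c\<close>.\<close>

definition cone_form :: "'k::field \<Rightarrow> 'k \<Rightarrow> 'k \<Rightarrow> 'k poly3" where
  "cone_form a b c = const3 a * var_x + const3 b * var_y + const3 c * var_z"

text \<open>The derivation module of the cone of \<open>C\<close>.  All degree one polynomials defining a given line
  are proportional, so quantifying over all of them is the same as choosing one.\<close>

definition log_derivations :: "('k::field ^ 2) set set \<Rightarrow> ('k poly3 \<Rightarrow> 'k poly3) set" where
  "log_derivations C = {\<theta> \<in> derivations.
     (\<forall>a b c. (a \<noteq> 0 \<or> b \<noteq> 0) \<and> line_zero_set a b c \<in> C \<longrightarrow>
        cone_form a b c dvd \<theta> (cone_form a b c)) \<and>
     var_z dvd \<theta> var_z}"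

definition free_with_exponents :: "('k::field ^ 2) set set \<Rightarrow> nat \<Rightarrow> nat \<Rightarrow> bool" where
  "free_with_exponents C d1 d2 \<longleftrightarrow>
     (\<exists>\<theta>1 \<theta>2. homogeneous_derivation d1 \<theta>1 \<and> homogeneous_derivation d2 \<theta>2 \<and>
        distinct [euler_derivation, \<theta>1, \<theta>2] \<and>
        der.independent {euler_derivation, \<theta>1, \<theta>2} \<and>
        der.span {euler_derivation, \<theta>1, \<theta>2} = log_derivations C)"

definition free_arrangement :: "('k::field ^ 2) set set \<Rightarrow> bool" where
  "free_arrangement C \<longleftrightarrow> (\<exists>d1 d2. free_with_exponents C d1 d2)"

end

theory Submission
  imports Defs
begin

text \<open>Write \<open>n = |C|\<close>. The characteristic polynomial of \<open>C\<close> is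
\<open>t\<^sup>2 - n t + e\<close>, where \<open>e = excess C\<close> is the sum of
\<open>(number of lines through p) - 1\<close> over the crossing points \<open>p\<close>. Adding to \<open>C\<close> a
line \<open>H\<close> that meets it in \<open>n\<^sub>H\<close> points raises \<open>n\<close> by one and \<open>e\<close> by
\<open>n\<^sub>H\<close>, so it does not change the value at \<open>n\<^sub>H\<close>. Everything therefore reduces to a line
\<open>H\<close> outside \<open>C\<close>. For such a line put \<open>d2 = n\<^sub>H\<close> and \<open>d1 = n - n\<^sub>H\<close>; then
the value at \<open>n\<^sub>H\<close> is \<open>e - d1 d2\<close>, and the claims become: \<open>d1 d2 \<le> e\<close>,
and \<open>C\<close> and \<open>C \<union> {H}\<close> are free if equality holds. The roots of the polynomial have
nonnegative sum and product, so a point strictly between their norms would be one where it is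
negative (\<open>no_value_between_root_norms\<close>).

Modulo the Euler derivation, a homogeneous derivation of degree \<open>k\<close> of the cone is a planar
polynomial vector field \<open>(f, g)\<close> of degree at most \<open>k\<close> (set \<open>z = 1\<close>) that is
tangent to every line of \<open>C\<close>. Let \<open>T(C, k)\<close> be the space of these fields. Two maps to
polynomials on \<open>H\<close> govern its dimension.

\<^item> The component of a field of \<open>T(C, k)\<close> normal to \<open>H\<close>, restricted to \<open>H\<close>, has
kernel \<open>T(C \<union> {H}, k)\<close>. It vanishes to order \<open>m - 1\<close> where \<open>H\<close> meets
\<open>m\<close> lines of \<open>C\<close>, and each parallel of \<open>H\<close> in \<open>C\<close> lowers its degree by one.
So its values fill at most \<open>k + 1 - d1\<close> dimensions (\<open>dim_tangent_delete\<close>).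

\<^item> A field of \<open>T(C \<union> {H}, k)\<close>, restricted to \<open>H\<close>, is tangent to \<open>H\<close> and vanishes
at the \<open>d2\<close> crossings on \<open>H\<close>; the kernel is \<open>T(C, k - 1)\<close> times the equation
of \<open>H\<close>. So its values fill at most \<open>k + 1 - d2\<close> dimensions
(\<open>dim_tangent_kernel\<close>, \<open>along_kernel\<close>).

Alternating the two bounds the dimension of \<open>T(C, k)\<close> from above by the one that it has when \<open>C\<close>
is free with exponents \<open>d1, d2\<close>. Removing the lines of \<open>C\<close> one after the other by the first
bound, down to the space of all fields of degree \<open>k\<close>, bounds it from below, and the
numbers of points that the successive lines contribute add up to \<open>e\<close>
(\<open>dim_tangent_lower_bound\<close>). For large \<open>k\<close> the comparison is exactly
\<open>d1 d2 \<le> e\<close> (\<open>excess_ge\<close>).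

If equality holds then no step can lose a dimension. Hence in degree \<open>d1\<close> there is a field
\<open>u\<close> of \<open>T(C, d1)\<close> that is not tangent to \<open>H\<close>, and in degree \<open>d2\<close> a field
\<open>v\<close> of \<open>T(C \<union> {H}, d2)\<close> that does not vanish on \<open>H\<close>. Their determinant is
nonzero on \<open>H\<close>, has degree at most \<open>d1 + d2 = n\<close>, and is divisible by the \<open>n\<close>
equations of the lines, so it is a constant times their product. By Saito's argument with Cramer's
rule, the homogenizations of \<open>u\<close> and \<open>v\<close> and the Euler derivation form a basis
(\<open>free_of_tangent_basis\<close>). For \<open>C \<union> {H}\<close> one multiplies \<open>u\<close> by the equation of
\<open>H\<close>.\<close>

section \<open>Evaluation of polynomials in two variables\<close>

text \<open>The substitutions needed below go from \<open>K[x][y]\<close> into \<open>K[t]\<close>, into \<open>K[x][y][z]\<close> and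
back into \<open>K[x][y]\<close>. All are instances of one evaluation map \<open>eval2\<close>, parametrized by the
embedding \<open>h\<close> of the constants.\<close>

definition ring_morphism :: "('a::comm_ring_1 \<Rightarrow> 'b::comm_ring_1) \<Rightarrow> bool" where
  "ring_morphism h \<longleftrightarrow> h 0 = 0 \<and> h 1 = 1 \<and>
     (\<forall>a b. h (a + b) = h a + h b) \<and> (\<forall>a b. h (a * b) = h a * h b)"

lemma ring_morphismD:
  assumes "ring_morphism h"
  shows "h 0 = 0" "h 1 = 1" "h (a + b) = h a + h b" "h (a * b) = h a * h b"
    "h (- a) = - h a" "h (a - b) = h a - h b" "h (a ^ n) = h a ^ n"
    "h (sum f A) = (\<Sum>x\<in>A. h (f x))" "h (prod f A) = (\<Prod>x\<in>A. h (f x))"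
proof -
  show h: "h 0 = 0" "h 1 = 1" "h (a + b) = h a + h b" "h (a * b) = h a * h b" for a b
    using assms by (auto simp: ring_morphism_def)
  show m: "h (- a) = - h a" for a
    using h(3)[of "- a" a] h(1) by (simp add: eq_neg_iff_add_eq_0)
  show "h (a - b) = h a - h b"
    using h(3)[of a "- b"] m[of b] by simp
  show "h (a ^ n) = h a ^ n"
    by (induction n) (simp_all add: h)
  show "h (sum f A) = (\<Sum>x\<in>A. h (f x))"
    by (induction A rule: infinite_finite_induct) (simp_all add: h)
  show "h (prod f A) = (\<Prod>x\<in>A. h (f x))"
    by (induction A rule: infinite_finite_induct) (simp_all add: h)
qed

lemma map_poly_add_additive:
  assumes "h 0 = 0" "\<And>a b. h (a + b) = h a + h b"
  shows "map_poly h (p + q) = map_poly h p + map_poly h q"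
  using assms by (intro poly_eqI) (simp add: coeff_map_poly)

lemma ring_morphism_map_poly:
  assumes "ring_morphism h"
  shows "ring_morphism (map_poly h)"
proof -
  note h = ring_morphismD[OF assms]
  have add: "map_poly h (p + q) = map_poly h p + map_poly h q" for p q
    by (intro map_poly_add_additive h)
  have smult: "map_poly h (smult a p) = smult (h a) (map_poly h p)" for a p
    by (intro poly_eqI) (simp add: coeff_map_poly h)
  have "map_poly h (p * q) = map_poly h p * map_poly h q" for p q
    by (induction p) (simp_all add: add smult h map_poly_pCons)
  then show ?thesis
    by (simp add: ring_morphism_def add h)
qed

lemma ring_morphism_comp: "ring_morphism h \<Longrightarrow> ring_morphism g \<Longrightarrow> ring_morphism (\<lambda>p. g (h p))"
  by (simp add: ring_morphism_def)

lemma ring_morphism_poly: "ring_morphism (\<lambda>p. poly p X)"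
  by (simp add: ring_morphism_def)

definition eval2 :: "('k::comm_ring_1 \<Rightarrow> 'a::comm_ring_1) \<Rightarrow> 'a \<Rightarrow> 'a \<Rightarrow> 'k poly poly \<Rightarrow> 'a" where
  "eval2 h X Y p = poly (map_poly (\<lambda>q. poly (map_poly h q) X) p) Y"

lemma ring_morphism_eval1:
  "ring_morphism h \<Longrightarrow> ring_morphism (\<lambda>q. poly (map_poly h q) X)"
  by (rule ring_morphism_comp[OF ring_morphism_map_poly ring_morphism_poly])

lemma ring_morphism_eval2: "ring_morphism h \<Longrightarrow> ring_morphism (eval2 h X Y)"
  unfolding eval2_def
  by (rule ring_morphism_comp[OF ring_morphism_map_poly[OF ring_morphism_eval1] ring_morphism_poly])

lemma eval2_pCons:
  assumes "ring_morphism h"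
  shows "eval2 h X Y (pCons q p) = poly (map_poly h q) X + Y * eval2 h X Y p"
  using ring_morphismD(1)[OF assms]
  by (simp add: eval2_def map_poly_pCons)

lemma eval2_gens:
  assumes "ring_morphism h"
  shows "eval2 h X Y [:[:c:]:] = h c" "eval2 h X Y [:[:0, 1:]:] = X" "eval2 h X Y [:0, 1:] = Y"
    "eval2 h X Y [:[:c, a:], [:b:]:] = h c + h a * X + h b * Y"
  using ring_morphismD[OF assms]
  by (simp_all add: eval2_def map_poly_pCons one_pCons algebra_simps)

text \<open>A ring morphism is determined by its values on the constants and the two variables. This turns the
identification of composed substitutions into a check on generators.\<close>

lemma eval2_unique:
  assumes "ring_morphism h" "ring_morphism g"
    "\<And>c. g [:[:c:]:] = h c" "g [:[:0, 1:]:] = X" "g [:0, 1:] = Y"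
  shows "g p = eval2 h X Y p"
proof (induction p)
  case 0
  then show ?case by (simp add: ring_morphismD[OF assms(2)] eval2_def)
next
  case (pCons q p)
  have *: "g [:q:] = poly (map_poly h q) X" for q
  proof (induction q)
    case 0
    then show ?case by (simp add: ring_morphismD[OF assms(2)])
  next
    case (pCons c q)
    have "g [:pCons c q:] = g ([:[:c:]:] + [:[:0,1:]:] * [:q:])" by simp
    also have "\<dots> = g [:[:c:]:] + g [:[:0,1:]:] * g [:q:]"
      by (simp only: ring_morphismD(3,4)[OF assms(2)])
    finally show ?case
      using pCons assms(3,4) ring_morphismD[OF assms(1)] by (simp add: map_poly_pCons)
  qed
  have "g (pCons q p) = g ([:q:] + [:0,1:] * p)" by simp
  also have "\<dots> = g [:q:] + g [:0, 1:] * g p"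
    by (simp only: ring_morphismD(3,4)[OF assms(2)])
  finally show ?case
    using pCons assms(5) * by (simp add: eval2_pCons[OF assms(1)])
qed

lemma eval2_cong_dvd:
  assumes "ring_morphism h" "d dvd X - X'" "d dvd Y - Y'"
  shows "d dvd eval2 h X Y p - eval2 h X' Y' p"
proof -
  have mult: "d dvd U * V - U' * V'" if "d dvd U - U'" "d dvd V - V'" for U V U' V' :: 'b
  proof -
    have "U * V - U' * V' = (U - U') * V + U' * (V - V')" by (simp add: algebra_simps)
    then show ?thesis using that by simp
  qed
  have add: "d dvd (U + V) - (U' + V')" if "d dvd U - U'" "d dvd V - V'" for U V U' V' :: 'b
    using dvd_add[OF that] by (simp add: algebra_simps)
  have q: "d dvd poly (map_poly h q) X - poly (map_poly h q) X'" for q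
    by (induction q) (auto simp: map_poly_pCons ring_morphismD[OF assms(1)] intro: mult assms)
  show ?thesis
    by (induction p) (auto simp: eval2_def map_poly_pCons ring_morphismD[OF assms(1)] intro!: mult add assms q)
qed

section \<open>Total degree and restriction to a line\<close>

definition deg_le :: "nat \<Rightarrow> 'k::field poly poly \<Rightarrow> bool" where
  "deg_le k p \<longleftrightarrow> (\<forall>i j. coeff (coeff p j) i \<noteq> 0 \<longrightarrow> i + j \<le> k)"

text \<open>The substitution \<open>x \<mapsto> x z\<close>, \<open>y \<mapsto> y z\<close> collects the monomials of total degree \<open>m\<close> in the
coefficient of \<open>z\<^sup>m\<close>. Being a ring morphism into polynomials in \<open>z\<close> over a domain, it makes
the total degree additive under products, which the coefficientwise description does not show.\<close>

definition graded :: "'k::field poly poly \<Rightarrow> 'k poly3" where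
  "graded = eval2 const3 (var_x * var_z) (var_y * var_z)"

lemma ring_morphism_const3: "ring_morphism const3"
  by (simp add: ring_morphism_def const3_def one_pCons)

lemma ring_morphism_const1: "ring_morphism (\<lambda>c. [:c:])"
  by (simp add: ring_morphism_def one_pCons)

lemma ring_morphism_graded: "ring_morphism graded"
  unfolding graded_def by (intro ring_morphism_eval2 ring_morphism_const3)

lemma coeff_graded:
  "coeff (coeff (coeff (graded p) m) j) i = (if m = i + j then coeff (coeff p j) i else 0)"
proof -
  have 1: "coeff (coeff (coeff (poly (map_poly const3 q) (var_x * var_z)) m) j) i
      = (if j = 0 \<and> m = i then coeff q i else 0)" for q :: "'a poly" and m i j
  proof (induction q arbitrary: m j i)
    case (pCons c q)
    have "poly (map_poly const3 (pCons c q)) (var_x * var_z)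
        = [:[:[:c:]:]:] + [:0, [:[:0, 1:]:]:] * poly (map_poly const3 q) (var_x * var_z)"
      by (subst map_poly_pCons) (simp_all add: const3_def var_x_def var_z_def)
    then show ?case
      by (auto simp: pCons(2) coeff_pCons split: nat.splits)
  qed simp
  show ?thesis
  proof (induction p arbitrary: m j i)
    case (pCons q p)
    have "graded (pCons q p)
        = poly (map_poly const3 q) (var_x * var_z) + [:0, [:0, 1:]:] * graded p"
      by (simp add: graded_def eval2_pCons[OF ring_morphism_const3] var_y_def var_z_def)
    then show ?case
      using pCons(2) by (auto simp: 1 coeff_pCons split: nat.splits)
  qed (simp add: graded_def eval2_def)
qed

lemma deg_le_iff_graded: "deg_le k p \<longleftrightarrow> degree (graded p) \<le> k"
proof
  assume "deg_le k p"
  then have "coeff (graded p) m = 0" if "m > k" for m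
    using that by (intro poly_eqI) (fastforce simp: coeff_graded deg_le_def add.commute)
  then show "degree (graded p) \<le> k"
    by (intro degree_le) auto
next
  assume d: "degree (graded p) \<le> k"
  show "deg_le k p"
    unfolding deg_le_def
  proof (intro allI impI)
    fix i j assume "coeff (coeff p j) i \<noteq> 0"
    then have "coeff (graded p) (i + j) \<noteq> 0"
      using coeff_graded[of p "i + j" j i] by auto
    then show "i + j \<le> k"
      using d le_degree by fastforce
  qed
qed

lemma graded_eq_0_iff [simp]: "graded p = 0 \<longleftrightarrow> p = 0"
proof
  assume "graded p = 0"
  then have "coeff (coeff p j) i = 0" for i j
    using coeff_graded[of p "i + j" j i] by simp
  then show "p = 0" by (simp add: poly_eq_iff)
qed (simp add: graded_def eval2_def)

lemma deg_le_simps [simp]: "deg_le k 0" "deg_le k [:[:c:]:]"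
  by (auto simp: deg_le_def coeff_pCons split: nat.splits)

lemma deg_le_add: "deg_le k p \<Longrightarrow> deg_le k q \<Longrightarrow> deg_le k (p + q)"
  by (simp add: deg_le_iff_graded ring_morphismD[OF ring_morphism_graded] degree_add_le)

lemma deg_le_diff: "deg_le k p \<Longrightarrow> deg_le k q \<Longrightarrow> deg_le k (p - q)"
  by (simp add: deg_le_iff_graded ring_morphismD[OF ring_morphism_graded] degree_diff_le)

lemma deg_le_mult: "deg_le k p \<Longrightarrow> deg_le l q \<Longrightarrow> deg_le (k + l) (p * q)"
  unfolding deg_le_iff_graded ring_morphismD[OF ring_morphism_graded]
  using degree_mult_le[of "graded p" "graded q"] by simp

lemma deg_le_smult: "deg_le k p \<Longrightarrow> deg_le k (smult [:c:] p)"
  by (simp add: deg_le_def)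

definition lin :: "'k::field \<Rightarrow> 'k \<Rightarrow> 'k \<Rightarrow> 'k poly poly" where
  "lin a b c = [:[:c, a:], [:b:]:]"

lemma deg_le_lin: "deg_le 1 (lin a b c)"
  by (auto simp: deg_le_def lin_def coeff_pCons split: nat.splits)

lemma deg_le_prod:
  "finite B \<Longrightarrow> (\<And>x. x \<in> B \<Longrightarrow> deg_le 1 (f x)) \<Longrightarrow> deg_le (card B) (prod f B)"
proof (induction B rule: finite_induct)
  case (insert x B)
  then show ?case using deg_le_mult[of 1 "f x" "card B"] by simp
qed (simp add: one_pCons)

lemma degree_graded_lin:
  assumes "a \<noteq> 0 \<or> b \<noteq> 0"
  shows "degree (graded (lin a b c)) = 1"
proof (rule antisym)
  show "degree (graded (lin a b c)) \<le> 1"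
    using deg_le_lin deg_le_iff_graded by blast
  have "\<not> deg_le 0 (lin a b c)"
    using assms by (auto simp: deg_le_def lin_def coeff_pCons split: nat.splits
        intro: exI[of _ 1] exI[of _ 0])
  then show "1 \<le> degree (graded (lin a b c))"
    by (simp add: deg_le_iff_graded)
qed

lemma degree_graded_mult:
  "p \<noteq> 0 \<Longrightarrow> q \<noteq> 0 \<Longrightarrow> degree (graded (p * q)) = degree (graded p) + degree (graded q)"
  by (simp add: ring_morphismD[OF ring_morphism_graded] degree_mult_eq)

lemma degree_graded_prod:
  "finite B \<Longrightarrow> (\<And>x. x \<in> B \<Longrightarrow> f x \<noteq> 0 \<and> degree (graded (f x)) = 1) \<Longrightarrow>
    degree (graded (prod f B)) = card B"
proof (induction B rule: finite_induct)
  case (insert x B)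
  then show ?case
    by (auto simp: degree_graded_mult)
qed (simp add: ring_morphismD[OF ring_morphism_graded])

lemma deg_le_mult_cancel:
  assumes "deg_le k (p * q)" "p \<noteq> 0" "q \<noteq> 0"
  shows "degree (graded p) \<le> k" "deg_le (k - degree (graded p)) q"
  using assms by (auto simp: deg_le_iff_graded degree_graded_mult)

lemma deg_le_0E:
  assumes "deg_le 0 p"
  obtains c where "p = [:[:c:]:]"
proof
  have "coeff (coeff p j) i = 0" if "i + j > 0" for i j
    using assms that by (auto simp: deg_le_def)
  then show "p = [:[:coeff (coeff p 0) 0:]:]"
    by (intro poly_eqI) (auto simp: coeff_pCons split: nat.splits)
qed

lemma degree_eval2_le:
  assumes "deg_le k p" "degree X \<le> 1" "degree Y \<le> 1"
  shows "degree (eval2 (\<lambda>c. [:c:]) X Y p) \<le> k"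
  using assms(1)
proof (induction p arbitrary: k)
  case (pCons q p)
  have X: "degree (poly (map_poly (\<lambda>c. [:c:]) q) X) \<le> degree q" for q
  proof (induction q)
    case (pCons c q)
    have "degree (X * poly (map_poly (\<lambda>c. [:c:]) q) X) \<le> degree (pCons c q)"
    proof (cases "q = 0")
      case False
      have "degree (X * poly (map_poly (\<lambda>c. [:c:]) q) X) \<le> 1 + degree q"
        using pCons(2) assms(2) degree_mult_le order_trans add_mono by meson
      then show ?thesis using False by simp
    qed simp
    then show ?case
      by (simp add: map_poly_pCons degree_add_le)
  qed simp
  have "coeff q i = 0" if "i > k" for i
    using pCons(3) that unfolding deg_le_def by (metis coeff_pCons_0 le_add1 order_trans not_less)
  then have q: "degree q \<le> k" by (intro degree_le) auto
  have "degree (Y * eval2 (\<lambda>c. [:c:]) X Y p) \<le> k"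
  proof (cases k)
    case 0
    have "p = 0"
    proof (rule poly_eqI)
      fix j
      have "coeff (coeff p j) i = 0" for i
        using pCons(3) 0 unfolding deg_le_def
        by (metis coeff_pCons_Suc add_Suc_right Suc_n_not_le_n le_0_eq nat.distinct(1))
      then show "coeff p j = coeff 0 j" by (simp add: poly_eq_iff)
    qed
    then show ?thesis by (simp add: eval2_def)
  next
    case (Suc l)
    have "deg_le l p"
      using pCons(3) Suc unfolding deg_le_def by (metis coeff_pCons_Suc add_Suc_right Suc_le_mono)
    then have "degree (eval2 (\<lambda>c. [:c:]) X Y p) \<le> l" by (rule pCons(2))
    then show ?thesis
      using degree_mult_le[of Y "eval2 (\<lambda>c. [:c:]) X Y p"] assms(3) Suc by simp
  qed
  then show ?case
    using q X[of q] by (simp add: eval2_pCons[OF ring_morphism_const1] degree_add_le)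
qed (simp add: eval2_def)

lemma eval2_comp:
  assumes "ring_morphism h" "ring_morphism g"
  shows "g (eval2 h X Y p) = eval2 (\<lambda>c. g (h c)) (g X) (g Y) p"
proof (rule eval2_unique)
  show "ring_morphism (\<lambda>c. g (h c))" using assms by (rule ring_morphism_comp)
  show "ring_morphism (\<lambda>p. g (eval2 h X Y p))"
    by (rule ring_morphism_comp[OF ring_morphism_eval2[OF assms(1)] assms(2)])
qed (simp_all add: eval2_gens assms)

lemma eval2_self: "eval2 (\<lambda>c. [:[:c:]:]) [:[:0, 1:]:] [:0, 1:] p = p"
proof -
  have "ring_morphism (\<lambda>c::'a. [:[:c:]:])" by (simp add: ring_morphism_def one_pCons)
  from eval2_unique[OF this, of "\<lambda>p. p"] show ?thesis by (simp add: ring_morphism_def)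
qed

text \<open>Restriction to the line through \<open>(x0, y0)\<close> with direction \<open>(b, - a)\<close>, in the parameter
\<open>t\<close> of \<open>(x0 + b t, y0 - a t)\<close>.\<close>

definition restr :: "'k::field \<Rightarrow> 'k \<Rightarrow> 'k \<Rightarrow> 'k \<Rightarrow> 'k poly poly \<Rightarrow> 'k poly" where
  "restr a b x0 y0 = eval2 (\<lambda>c. [:c:]) [:x0, b:] [:y0, - a:]"

lemma ring_morphism_restr: "ring_morphism (restr a b x0 y0)"
  unfolding restr_def by (intro ring_morphism_eval2 ring_morphism_const1)

lemmas restr_hom [simp] = ring_morphismD[OF ring_morphism_restr]

lemma restr_const [simp]: "restr a b x0 y0 [:[:c:]:] = [:c:]"
  by (simp add: restr_def eval2_gens[OF ring_morphism_const1])

lemma restr_smult [simp]: "restr a b x0 y0 (smult [:c:] p) = smult c (restr a b x0 y0 p)"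
  using restr_hom(4)[of a b x0 y0 "[:[:c:]:]" p] by simp

lemma restr_lin: "restr a b x0 y0 (lin a' b' c') = [:a' * x0 + b' * y0 + c', a' * b - b' * a:]"
  by (simp add: restr_def lin_def eval2_gens[OF ring_morphism_const1])

lemma degree_restr_le: "deg_le k p \<Longrightarrow> degree (restr a b x0 y0 p) \<le> k"
  unfolding restr_def by (intro degree_eval2_le) auto

text \<open>The parameter \<open>t\<close> lifts to a linear form \<open>l\<close>, and modulo \<open>a x + b y + c\<close> both variables
are polynomials in \<open>l\<close>: those that parametrize the line. Hence every \<open>p\<close> is congruent to its
restriction evaluated at \<open>l\<close>, so a vanishing restriction forces divisibility.\<close>

lemma lin_dvd_iff_restr:
  fixes a b :: "'k::field"
  assumes ab: "a \<noteq> 0 \<or> b \<noteq> 0" and on: "a * x0 + b * y0 + c = 0"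
  shows "lin a b c dvd p \<longleftrightarrow> restr a b x0 y0 p = 0"
proof
  assume "lin a b c dvd p"
  then show "restr a b x0 y0 p = 0"
    using on by (auto simp: dvd_def restr_lin)
next
  assume 0: "restr a b x0 y0 p = 0"
  \<comment> \<open>a linear form with value \<open>1\<close> on the direction \<open>(b, - a)\<close>\<close>
  obtain r s where rs: "r * b - s * a = 1"
  proof (cases "b = 0")
    case True
    then show ?thesis using ab that[of 0 "- 1 / a"] by simp
  next
    case False
    then show ?thesis using that[of "1 / b" 0] by simp
  qed
  define l where "l = lin r s (- r * x0 - s * y0)"
  define lft where "lft = (\<lambda>q :: 'k poly. poly (map_poly (\<lambda>c. [:[:c:]:]) q) l)"
  have h: "ring_morphism (\<lambda>c::'k. [:[:c:]:])" by (simp add: ring_morphism_def one_pCons)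
  have lft: "ring_morphism lft"
    unfolding lft_def by (intro ring_morphism_eval1 h)
  have c: "c = - a * x0 - b * y0" using on by (simp add: eq_neg_iff_add_eq_0 algebra_simps)
  have b1: "lft [:u, v:] = [:[:u:]:] + [:[:v:]:] * l" for u v
    by (simp add: lft_def map_poly_pCons)
  have rb: "r * b = 1 + s * a" using rs by (simp add: algebra_simps)
  have "s * (a * x0) + x0 = b * (r * x0)" "s * (a * y0) + y0 = b * (r * y0)"
    using rb by algebra+
  note eqs = this rb
  have "[:[:0, 1:]:] - lft [:x0, b:] = [:[:- s:]:] * lin a b c"
    unfolding b1 l_def lin_def c using eqs by (simp add: algebra_simps)
  moreover have "[:0, 1:] - lft [:y0, - a:] = [:[:r:]:] * lin a b c"
    unfolding b1 l_def lin_def c using eqs by (simp add: algebra_simps)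
  ultimately have "lin a b c dvd eval2 (\<lambda>c. [:[:c:]:]) [:[:0, 1:]:] [:0, 1:] p -
      eval2 (\<lambda>c. [:[:c:]:]) (lft [:x0, b:]) (lft [:y0, - a:]) p"
    by (intro eval2_cong_dvd h; metis dvd_triv_right)
  moreover have "lft (restr a b x0 y0 p) =
      eval2 (\<lambda>c. [:[:c:]:]) (lft [:x0, b:]) (lft [:y0, - a:]) p"
    unfolding restr_def eval2_comp[OF ring_morphism_const1 lft]
    by (simp add: lft_def map_poly_pCons)
  ultimately show "lin a b c dvd p"
    using 0 ring_morphismD(1)[OF lft] by (simp add: eval2_self)
qed

lemma prime_lin:
  assumes "a \<noteq> 0 \<or> b \<noteq> 0" "a * x0 + b * y0 + c = 0"
  shows "prime_elem (lin a b c)"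
proof (rule prime_elemI)
  show "lin a b c \<noteq> 0" using assms by (auto simp: lin_def)
  show "\<not> lin a b c dvd 1" by (simp add: lin_dvd_iff_restr[OF assms])
  show "lin a b c dvd p \<or> lin a b c dvd q" if "lin a b c dvd p * q" for p q
    using that by (simp add: lin_dvd_iff_restr[OF assms])
qed

section \<open>Counting dimensions\<close>

text \<open>The space of all planar fields is infinite-dimensional, and only upper bounds for
dimensions are ever combined. So a dimension is represented by the size of a finite spanning set,
and lower bounds enter once, through an explicit independent family.\<close>

locale dimension_bounds = vector_space scale for scale :: "'a::field \<Rightarrow> 'b::ab_group_add \<Rightarrow> 'b"
begin

definition dim_le :: "'b set \<Rightarrow> nat \<Rightarrow> bool" where
  "dim_le U m \<longleftrightarrow> (\<exists>S. finite S \<and> card S \<le> m \<and> U \<subseteq> span S)"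

lemma dim_le_mono: "dim_le U m \<Longrightarrow> V \<subseteq> U \<Longrightarrow> m \<le> n \<Longrightarrow> dim_le V n"
  unfolding dim_le_def by (meson order_trans)

lemma dim_le_zero: "dim_le {0} 0"
  unfolding dim_le_def by (intro exI[of _ "{}"]) simp

lemma card_independent_le: "dim_le U m \<Longrightarrow> independent B \<Longrightarrow> B \<subseteq> U \<Longrightarrow> card B \<le> m"
  unfolding dim_le_def using independent_span_bound by (meson order_trans)

lemma dim_le_image:
  assumes "dim_le U m" "\<And>u v. f (u + v) = f u + f v" "\<And>c u. f (scale c u) = scale c (f u)"
  shows "dim_le (f ` U) m"
proof -
  obtain S where S: "finite S" "card S \<le> m" "U \<subseteq> span S"
    using assms(1) by (auto simp: dim_le_def)
  have f0: "f 0 = 0" using assms(3)[of 0 0] by simp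
  have "f u \<in> span (f ` S)" if "u \<in> span S" for u
    using that by (induction rule: span_induct_alt) (auto simp: f0 assms intro: span_zero span_add span_scale span_base)
  then show ?thesis
    unfolding dim_le_def using S card_image_le[OF S(1), of f]
    by (intro exI[of _ "f ` S"]) auto
qed

text \<open>Values of \<open>f\<close> are multiples \<open>P q\<close> with \<open>degree q < m\<close>, so \<open>m\<close> linear functionals cut the
kernel out of \<open>U\<close>. They are removed one at a time, the top coefficient first: if
it is nonzero at some \<open>w\<close> of \<open>U\<close>, then \<open>w\<close> and the subspace where it vanishes span \<open>U\<close>.\<close>

lemma dim_le_of_kernel:
  fixes f :: "'b \<Rightarrow> 'a poly"
  assumes "subspace U"
    and "\<And>u v. f (u + v) = f u + f v" "\<And>c u. f (scale c u) = smult c (f u)"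
    and "\<And>u. u \<in> U \<Longrightarrow> P dvd f u"
    and "\<And>u. u \<in> U \<Longrightarrow> f u = 0 \<or> degree (f u) < degree P + m"
    and "dim_le {u \<in> U. f u = 0} l"
  shows "dim_le U (l + m)"
  using assms(1,4-)
proof (induction m arbitrary: U)
  case 0
  have "f u = 0" if "u \<in> U" for u
    using 0(2,3)[OF that] dvd_imp_degree_le[of P "f u"] by fastforce
  then have "{u \<in> U. f u = 0} = U" by auto
  then show ?case using 0(4) by simp
next
  case (Suc m)
  define \<phi> where "\<phi> u = coeff (f u) (degree P + m)" for u
  define W where "W = {u \<in> U. \<phi> u = 0}"
  have f0: "f 0 = 0" using assms(3)[of 0 0] by simp
  have \<phi>: "\<phi> (u + v) = \<phi> u + \<phi> v" "\<phi> (scale c u) = c * \<phi> u" for u v c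
    by (simp_all add: \<phi>_def assms(2,3))
  have "subspace W"
    using Suc(2) f0 by (auto simp: W_def subspace_def \<phi>) (simp add: \<phi>_def)
  moreover have "f u = 0 \<or> degree (f u) < degree P + m" if "u \<in> W" for u
  proof (rule ccontr)
    assume "\<not> ?thesis"
    then have "f u \<noteq> 0" "degree (f u) = degree P + m"
      using Suc(4)[of u] that by (auto simp: W_def)
    then show False
      using that by (metis (mono_tags, lifting) W_def \<phi>_def leading_coeff_0_iff mem_Collect_eq)
  qed
  moreover have "{u \<in> W. f u = 0} = {u \<in> U. f u = 0}"
    by (auto simp: W_def \<phi>_def)
  ultimately have "dim_le W (l + m)"
    using Suc(3,5) by (intro Suc.IH) (auto simp: W_def)
  then obtain S where S: "finite S" "card S \<le> l + m" "W \<subseteq> span S"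
    by (auto simp: dim_le_def)
  show ?case
  proof (cases "W = U")
    case True
    then show ?thesis using S by (auto simp: dim_le_def)
  next
    case False
    then obtain w where w: "w \<in> U" "\<phi> w \<noteq> 0" by (auto simp: W_def)
    have "u \<in> span (insert w S)" if "u \<in> U" for u
    proof -
      have "u - scale (\<phi> u / \<phi> w) w = u + scale (- (\<phi> u / \<phi> w)) w" by simp
      also have "\<dots> \<in> W"
        unfolding W_def using Suc(2) that w
        by (auto simp: \<phi> simp del: scale_minus_left intro: subspace_add subspace_scale)
      finally show ?thesis using S(3) by (auto simp: span_breakdown_eq)
    qed
    then show ?thesis
      unfolding dim_le_def using S card_insert_le_m1
      by (intro exI[of _ "insert w S"]) (auto simp: card_insert_if)
  qed
qed

text \<open>A functional that is nonzero on \<open>b\<close> and zero on the other vectors is zero on their span, which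
therefore does not contain \<open>b\<close>.\<close>

lemma independent_of_dual:
  assumes "\<And>b. b \<in> B \<Longrightarrow> \<exists>\<phi> :: 'b \<Rightarrow> 'a. (\<forall>u v. \<phi> (u + v) = \<phi> u + \<phi> v) \<and> (\<forall>c u. \<phi> (scale c u) = c * \<phi> u)
    \<and> \<phi> b \<noteq> 0 \<and> (\<forall>b' \<in> B - {b}. \<phi> b' = 0)"
  shows "independent B"
proof
  assume "dependent B"
  then obtain b where b: "b \<in> B" "b \<in> span (B - {b})" by (auto simp: dependent_def)
  obtain \<phi> :: "'b \<Rightarrow> 'a" where \<phi>: "\<And>u v. \<phi> (u + v) = \<phi> u + \<phi> v"
      "\<And>c u. \<phi> (scale c u) = c * \<phi> u" "\<phi> b \<noteq> 0" "\<And>b'. b' \<in> B - {b} \<Longrightarrow> \<phi> b' = 0"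
    using assms[OF b(1)] by blast
  have \<phi>0: "\<phi> 0 = 0" using \<phi>(2)[of 0 0] by simp
  have "\<phi> u = 0" if "u \<in> span (B - {b})" for u
    using that by (induction rule: span_induct_alt) (auto simp: \<phi>0 \<phi>)
  then show False using b \<phi>(3) by auto
qed

end

text \<open>A pair \<open>(f, g)\<close> stands for the vector field \<open>f \<partial>\<^sub>x + g \<partial>\<^sub>y\<close> on the plane.\<close>

definition fscale :: "'k::field \<Rightarrow> 'k poly poly \<times> 'k poly poly \<Rightarrow> 'k poly poly \<times> 'k poly poly" where
  "fscale c v = (smult [:c:] (fst v), smult [:c:] (snd v))"

interpretation fields: dimension_bounds fscale
proof
  have [simp]: "[:c:] = 1 \<longleftrightarrow> c = 1" for c :: 'a by (simp add: one_pCons)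
  show "fscale 1 v = v" for v :: "'a poly poly \<times> 'a poly poly"
    using smult_1_left[where 'a = "'a poly"] by (simp add: fscale_def one_pCons)
  show "fscale (c + d) v = fscale c v + fscale d v" for c d and v :: "'a poly poly \<times> 'a poly poly"
    using smult_add_left[of "[:c:]" "[:d:]"] by (simp add: fscale_def plus_prod_def)
qed (auto simp: fscale_def smult_add_right mult.commute)

definition all_fields :: "nat \<Rightarrow> ('k::field poly poly \<times> 'k poly poly) set" where
  "all_fields k = {v. deg_le k (fst v) \<and> deg_le k (snd v)}"

text \<open>The number of monomials of total degree at most \<open>d\<close> in two variables, doubled to avoid division.\<close>

lemma card_triangle: "2 * card {(i, j). i + j \<le> (d::nat)} = (d + 1) * (d + 2)"
proof -
  have "{(i, j). i + j \<le> d} = Sigma {..d} (\<lambda>i. {..d - i})" by auto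
  then have "card {(i, j). i + j \<le> d} = (\<Sum>i\<le>d. Suc (d - i))" by simp
  also have "\<dots> = (\<Sum>i\<le>d. Suc i)"
    using sum.nat_diff_reindex[of Suc "Suc d"] by (simp add: lessThan_Suc_atMost)
  also have "2 * \<dots> = (d + 1) * (d + 2)"
    by (induction d) auto
  finally show ?thesis .
qed

lemma all_fields_dim:
  assumes "fields.dim_le (all_fields k :: ('k::field poly poly \<times> 'k poly poly) set) m"
  shows "(k + 1) * (k + 2) \<le> m"
proof -
  define I :: "(bool \<times> nat \<times> nat) set" where "I = UNIV \<times> {(i, j). i + j \<le> k}"
  define b :: "bool \<times> nat \<times> nat \<Rightarrow> 'k poly poly \<times> 'k poly poly" where
    "b = (\<lambda>(s, i, j). if s then (monom (monom 1 i) j, 0) else (0, monom (monom 1 i) j))"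
  define \<phi> :: "bool \<times> nat \<times> nat \<Rightarrow> 'k poly poly \<times> 'k poly poly \<Rightarrow> 'k" where
    "\<phi> = (\<lambda>(s, i, j) v. coeff (coeff (if s then fst v else snd v) j) i)"
  have \<phi>b: "\<phi> x (b y) = (if x = y then 1 else 0)" for x y
    by (cases x; cases y) (auto simp: \<phi>_def b_def coeff_monom)
  have inj: "inj_on b I"
    by (rule inj_onI) (metis \<phi>b zero_neq_one)
  have "fields.independent (b ` I)"
  proof (rule fields.independent_of_dual)
    fix c assume "c \<in> b ` I"
    then obtain x where x: "c = b x" by auto
    show "\<exists>\<phi>. (\<forall>u v. \<phi> (u + v) = \<phi> u + \<phi> v) \<and> (\<forall>c u. \<phi> (fscale c u) = c * \<phi> u)
        \<and> \<phi> c \<noteq> (0 :: 'k) \<and> (\<forall>b' \<in> b ` I - {c}. \<phi> b' = 0)"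
    proof (intro exI[of _ "\<phi> x"] conjI ballI allI)
      show "\<phi> x c \<noteq> 0" by (simp add: x \<phi>b)
      show "\<phi> x b' = 0" if "b' \<in> b ` I - {c}" for b'
        using that by (auto simp: x \<phi>b)
    qed (auto simp: \<phi>_def fscale_def split: prod.splits)
  qed
  moreover have "b ` I \<subseteq> all_fields k"
    by (auto simp: b_def I_def all_fields_def deg_le_def coeff_monom split: if_splits)
  ultimately have "card (b ` I) \<le> m"
    using assms fields.card_independent_le by blast
  moreover have "card (b ` I) = 2 * card {(i, j). i + j \<le> k}"
    unfolding card_image[OF inj] by (simp add: I_def card_cartesian_product)
  ultimately show ?thesis using card_triangle[of k] by simp
qed

section \<open>Coordinates on lines\<close>

text \<open>Every line gets a fixed equation \<open>a x + b y + c\<close>, a base point \<open>(x, y)\<close> for its parametrization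
in the direction \<open>(b, - a)\<close>, and a covector \<open>(r, s)\<close> which together with \<open>(a, b)\<close> has
determinant \<open>1\<close>. A field is then recovered from its component along \<open>(a, b)\<close>, normal to the line,
and its component along \<open>(r, s)\<close>, which measures it on the line once the normal part vanishes there.\<close>

definition frame :: "('k::field ^ 2) set \<Rightarrow> 'k \<times> 'k \<times> 'k \<times> 'k \<times> 'k \<times> 'k \<times> 'k" where
  "frame H = (SOME (a, b, c, x, y, r, s). (a \<noteq> 0 \<or> b \<noteq> 0) \<and> H = line_zero_set a b c \<and>
     a * x + b * y + c = 0 \<and> a * s - b * r = 1)"

definition coeff_a :: "('k::field ^ 2) set \<Rightarrow> 'k" where "coeff_a H = (case frame H of (a, b, c, x, y, r, s) \<Rightarrow> a)"
definition coeff_b :: "('k::field ^ 2) set \<Rightarrow> 'k" where "coeff_b H = (case frame H of (a, b, c, x, y, r, s) \<Rightarrow> b)"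
definition coeff_c :: "('k::field ^ 2) set \<Rightarrow> 'k" where "coeff_c H = (case frame H of (a, b, c, x, y, r, s) \<Rightarrow> c)"
definition base_x :: "('k::field ^ 2) set \<Rightarrow> 'k" where "base_x H = (case frame H of (a, b, c, x, y, r, s) \<Rightarrow> x)"
definition base_y :: "('k::field ^ 2) set \<Rightarrow> 'k" where "base_y H = (case frame H of (a, b, c, x, y, r, s) \<Rightarrow> y)"
definition dual_r :: "('k::field ^ 2) set \<Rightarrow> 'k" where "dual_r H = (case frame H of (a, b, c, x, y, r, s) \<Rightarrow> r)"
definition dual_s :: "('k::field ^ 2) set \<Rightarrow> 'k" where "dual_s H = (case frame H of (a, b, c, x, y, r, s) \<Rightarrow> s)"

lemma frame_props:
  fixes H :: "('k::field ^ 2) set"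
  assumes "H \<in> affine_lines"
  shows "coeff_a H \<noteq> 0 \<or> coeff_b H \<noteq> 0"
    and "H = line_zero_set (coeff_a H) (coeff_b H) (coeff_c H)"
    and "coeff_a H * base_x H + coeff_b H * base_y H + coeff_c H = 0"
    and "coeff_a H * dual_s H - coeff_b H * dual_r H = 1"
proof -
  obtain a b c where H: "H = line_zero_set a b c" and ab: "a \<noteq> 0 \<or> b \<noteq> 0"
    using assms by (auto simp: affine_lines_def)
  have "\<exists>x y r s. a * x + b * y + c = 0 \<and> a * s - b * r = 1"
  proof (cases "a = 0")
    case True
    then have "a * 0 + b * (- c / b) + c = 0 \<and> a * 0 - b * (- 1 / b) = 1" using ab by simp
    then show ?thesis by blast
  next
    case False
    then have "a * (- c / a) + b * 0 + c = 0 \<and> a * (1 / a) - b * 0 = 1" by simp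
    then show ?thesis by blast
  qed
  then obtain x y r s where "a * x + b * y + c = 0" "a * s - b * r = 1" by blast
  then have "\<exists>z. case z of (a, b, c, x, y, r, s) \<Rightarrow> (a \<noteq> 0 \<or> b \<noteq> 0) \<and> H = line_zero_set a b c \<and>
     a * x + b * y + c = 0 \<and> a * s - b * r = 1"
    using H ab by (intro exI[of _ "(a, b, c, x, y, r, s)"]) simp
  then have "case frame H of (a, b, c, x, y, r, s) \<Rightarrow> (a \<noteq> 0 \<or> b \<noteq> 0) \<and> H = line_zero_set a b c \<and>
     a * x + b * y + c = 0 \<and> a * s - b * r = 1"
    unfolding frame_def by (rule someI_ex)
  then show "coeff_a H \<noteq> 0 \<or> coeff_b H \<noteq> 0"
    and "H = line_zero_set (coeff_a H) (coeff_b H) (coeff_c H)"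
    and "coeff_a H * base_x H + coeff_b H * base_y H + coeff_c H = 0"
    and "coeff_a H * dual_s H - coeff_b H * dual_r H = 1"
    by (auto simp: coeff_a_def coeff_b_def coeff_c_def base_x_def base_y_def dual_r_def dual_s_def
        split: prod.splits)
qed

lemma on_line_iff:
  "H \<in> affine_lines \<Longrightarrow> p \<in> H \<longleftrightarrow> coeff_a H * p $ 1 + coeff_b H * p $ 2 + coeff_c H = 0"
  by (subst frame_props(2)) (auto simp: line_zero_set_def)

lemma proportional_pairs:
  fixes a b a' b' :: "'k::field"
  assumes "a \<noteq> 0 \<or> b \<noteq> 0" "a' * b = b' * a"
  obtains l where "a' = l * a" "b' = l * b"
proof (cases "a = 0")
  case True
  then show ?thesis using assms that[of "b' / b"] by auto
next
  case False
  then show ?thesis using assms that[of "a' / a"] by (auto simp: field_simps)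
qed

lemma line_zero_set_eq_of_parallel:
  fixes a b a' b' c c' :: "'k::field"
  assumes "a \<noteq> 0 \<or> b \<noteq> 0" "a' \<noteq> 0 \<or> b' \<noteq> 0" "a' * b = b' * a"
    and "a * x + b * y + c = 0" "a' * x + b' * y + c' = 0"
  shows "line_zero_set a b c = line_zero_set a' b' c'"
proof -
  obtain l where l: "a' = l * a" "b' = l * b"
    using proportional_pairs assms by metis
  then have "l \<noteq> 0" using assms by auto
  have "c' = l * c" using assms(4,5) unfolding l by algebra
  then have "a' * u + b' * v + c' = l * (a * u + b * v + c)" for u v
    by (simp add: l algebra_simps)
  then show ?thesis using \<open>l \<noteq> 0\<close> by (simp add: line_zero_set_def)
qed

lemma lines_meeting_not_parallel:
  assumes "H \<in> affine_lines" "H' \<in> affine_lines" "H \<noteq> H'" "p \<in> H" "p \<in> H'"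
  shows "coeff_a H' * coeff_b H - coeff_b H' * coeff_a H \<noteq> 0"
  using assms line_zero_set_eq_of_parallel frame_props(1,2) on_line_iff
  by (metis eq_iff_diff_eq_0)

text \<open>Otherwise Cramer's rule produces a common point.\<close>

lemma lines_disjoint_parallel:
  fixes H :: "('k::field ^ 2) set"
  assumes "H \<in> affine_lines" "H' \<in> affine_lines" "H \<inter> H' = {}"
  shows "coeff_a H' * coeff_b H = coeff_b H' * coeff_a H"
proof (rule ccontr)
  define a b c a' b' c' where ab: "a = coeff_a H" "b = coeff_b H" "c = coeff_c H"
    "a' = coeff_a H'" "b' = coeff_b H'" "c' = coeff_c H'"
  assume "\<not> ?thesis"
  then have D: "a' * b - b' * a \<noteq> 0" by (simp add: ab)
  define p :: "'k ^ 2" where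
    "p = vector [(b' * c - b * c') / (a' * b - b' * a), (a * c' - a' * c) / (a' * b - b' * a)]"
  have "(a' * b - b' * a) * (a * p $ 1 + b * p $ 2 + c) = 0"
    "(a' * b - b' * a) * (a' * p $ 1 + b' * p $ 2 + c') = 0"
    using D by (simp_all add: p_def distrib_left mult.left_commute[of "a' * b - b' * a"])
      (simp_all add: algebra_simps)
  then have "a * p $ 1 + b * p $ 2 + c = 0" "a' * p $ 1 + b' * p $ 2 + c' = 0"
    using D by simp_all
  then have "p \<in> H \<inter> H'"
    using assms on_line_iff by (auto simp: ab)
  then show False using assms(3) by auto
qed

lemma point_on_two_lines_unique:
  assumes "H \<in> affine_lines" "H' \<in> affine_lines" "H \<noteq> H'" "p \<in> H" "p \<in> H'" "q \<in> H" "q \<in> H'"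
  shows "p = q"
proof -
  define a b c a' b' c' where ab: "a = coeff_a H" "b = coeff_b H" "c = coeff_c H"
    "a' = coeff_a H'" "b' = coeff_b H'" "c' = coeff_c H'"
  have D: "a' * b - b' * a \<noteq> 0" using lines_meeting_not_parallel assms by (simp add: ab)
  have e: "a * p $ 1 + b * p $ 2 + c = 0" "a' * p $ 1 + b' * p $ 2 + c' = 0"
    "a * q $ 1 + b * q $ 2 + c = 0" "a' * q $ 1 + b' * q $ 2 + c' = 0"
    using assms on_line_iff by (auto simp: ab)
  have "(a' * b - b' * a) * (p $ 1 - q $ 1) = 0" "(a' * b - b' * a) * (p $ 2 - q $ 2) = 0"
    using e by algebra+
  then show ?thesis using D by (simp add: vec_eq_iff forall_2)
qed

text \<open>The parameter of a point of \<open>H\<close>; the covector \<open>(r, s)\<close> has the value \<open>- 1\<close> on the direction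
\<open>(b, - a)\<close>, hence the reversed differences.\<close>

definition param :: "('k::field ^ 2) set \<Rightarrow> 'k ^ 2 \<Rightarrow> 'k" where
  "param H p = dual_r H * (base_x H - p $ 1) + dual_s H * (base_y H - p $ 2)"

lemma param_point:
  assumes "H \<in> affine_lines" "p \<in> H"
  shows "p $ 1 = base_x H + coeff_b H * param H p" "p $ 2 = base_y H - coeff_a H * param H p"
proof -
  note f = frame_props(3,4)[OF assms(1)] assms(2)[unfolded on_line_iff[OF assms(1)]]
  show "p $ 1 = base_x H + coeff_b H * param H p" "p $ 2 = base_y H - coeff_a H * param H p"
    unfolding param_def using f by algebra+
qed

lemma param_inj: "H \<in> affine_lines \<Longrightarrow> inj_on (param H) H"
  by (intro inj_onI) (auto simp: vec_eq_iff forall_2 param_point)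

definition form :: "('k::field ^ 2) set \<Rightarrow> 'k poly poly" where
  "form H = lin (coeff_a H) (coeff_b H) (coeff_c H)"

definition restrict_to :: "('k::field ^ 2) set \<Rightarrow> 'k poly poly \<Rightarrow> 'k poly" where
  "restrict_to H = restr (coeff_a H) (coeff_b H) (base_x H) (base_y H)"

definition normal :: "('k::field ^ 2) set \<Rightarrow> 'k poly poly \<times> 'k poly poly \<Rightarrow> 'k poly poly" where
  "normal H v = smult [:coeff_a H:] (fst v) + smult [:coeff_b H:] (snd v)"

definition along :: "('k::field ^ 2) set \<Rightarrow> 'k poly poly \<times> 'k poly poly \<Rightarrow> 'k poly poly" where
  "along H v = smult [:dual_r H:] (fst v) + smult [:dual_s H:] (snd v)"

lemma ring_morphism_restrict_to: "ring_morphism (restrict_to H)"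
  by (simp add: restrict_to_def ring_morphism_restr)

lemmas restrict_to_hom [simp] = ring_morphismD[OF ring_morphism_restrict_to]

lemma restrict_to_const [simp]: "restrict_to H [:[:c:]:] = [:c:]"
  and restrict_to_smult [simp]: "restrict_to H (smult [:c:] p) = smult c (restrict_to H p)"
  by (simp_all add: restrict_to_def)

lemma form_dvd_iff: "H \<in> affine_lines \<Longrightarrow> form H dvd p \<longleftrightarrow> restrict_to H p = 0"
  unfolding form_def restrict_to_def by (rule lin_dvd_iff_restr) (use frame_props in auto)

lemma restrict_to_form_at_point:
  assumes "H \<in> affine_lines" "H' \<in> affine_lines" "p \<in> H" "p \<in> H'"
  shows "restrict_to H (form H') =
    smult (coeff_a H' * coeff_b H - coeff_b H' * coeff_a H) [:- param H p, 1:]"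
  using param_point[OF assms(1,3)] assms(4)[unfolded on_line_iff[OF assms(2)]]
  by (auto simp: restrict_to_def form_def restr_lin) algebra

lemma form_nonzero:
  assumes "H \<in> affine_lines"
  shows "form H \<noteq> 0"
  using frame_props(1)[OF assms] by (auto simp: form_def lin_def)

lemma prime_form: "H \<in> affine_lines \<Longrightarrow> prime_elem (form H)"
  unfolding form_def by (rule prime_lin) (rule frame_props; assumption)+

lemma form_dvd_form_iff:
  assumes "H \<in> affine_lines" "H' \<in> affine_lines"
  shows "form H dvd form H' \<longleftrightarrow> H = H'"
proof
  assume "form H dvd form H'"
  then have "coeff_a H' * base_x H + coeff_b H' * base_y H + coeff_c H' = 0"
      "coeff_a H' * coeff_b H = coeff_b H' * coeff_a H"
    using form_dvd_iff[OF assms(1)] by (auto simp: restrict_to_def form_def restr_lin)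
  then show "H = H'"
    using line_zero_set_eq_of_parallel frame_props assms by metis
qed auto

lemma prime_elem_dvd_prodE:
  fixes f :: "'i \<Rightarrow> 'a::idom"
  assumes "prime_elem p" "finite B" "p dvd prod f B"
  obtains y where "y \<in> B" "p dvd f y"
  using assms(2,3) by (induction B rule: finite_induct)
    (use assms(1) in \<open>auto dest: prime_elem_not_unit prime_elem_dvd_multD\<close>)

lemma prod_dvd_of_prime_dvd:
  fixes f :: "'i \<Rightarrow> 'a::idom"
  assumes "finite B" "\<And>x. x \<in> B \<Longrightarrow> prime_elem (f x)"
    "\<And>x y. x \<in> B \<Longrightarrow> y \<in> B \<Longrightarrow> x \<noteq> y \<Longrightarrow> \<not> f x dvd f y" "\<And>x. x \<in> B \<Longrightarrow> f x dvd P"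
  shows "prod f B dvd P"
  using assms
proof (induction B rule: finite_induct)
  case (insert x B)
  then have "prod f B dvd P" by simp
  then obtain Q where Q: "P = prod f B * Q" by (auto simp: dvd_def)
  have x: "prime_elem (f x)" using insert.prems by simp
  have "\<not> f x dvd prod f B"
  proof
    assume "f x dvd prod f B"
    with \<open>finite B\<close> obtain y where "y \<in> B" "f x dvd f y"
      using prime_elem_dvd_prodE[OF x] by metis
    then show False using insert.prems(2)[of x y] insert.hyps by auto
  qed
  then have "f x dvd Q"
    using insert.prems(3)[of x] Q prime_elem_dvd_multD[OF x] by blast
  then show ?case using insert Q by (simp add: mult.commute[of "f x"] mult_dvd_mono)
qed simp

lemma prod_forms_dvd:
  assumes "line_arrangement C" "B \<subseteq> C" "\<And>H. H \<in> B \<Longrightarrow> form H dvd p"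
  shows "prod form B dvd p"
proof (rule prod_dvd_of_prime_dvd)
  show "finite B" using assms finite_subset by (auto simp: line_arrangement_def)
qed (use assms in \<open>auto simp: line_arrangement_def prime_form form_dvd_form_iff subset_iff\<close>)

text \<open>A root of one factor is not a root of the others, so the orders of vanishing can be compared point by
point.\<close>

lemma prod_linear_powers_dvd:
  fixes p :: "'k::field poly"
  assumes "finite T" "\<And>a. a \<in> T \<Longrightarrow> [:- a, 1:] ^ n a dvd p"
  shows "(\<Prod>a\<in>T. [:- a, 1:] ^ n a) dvd p"
  using assms
proof (induction T rule: finite_induct)
  case (insert a T)
  define R where "R = (\<Prod>a\<in>T. [:- a, 1:] ^ n a)"
  have R: "R \<noteq> 0" by (simp add: R_def insert.hyps(1))
  have "R dvd p" using insert by (simp add: R_def)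
  then obtain Q where Q: "p = R * Q" by (auto simp: dvd_def)
  have "poly R a \<noteq> 0"
    using insert.hyps by (auto simp: R_def poly_prod)
  then have "order a R = 0" by (simp add: order_root)
  then have "[:- a, 1:] ^ n a dvd Q"
    using insert.prems[of a] R by (cases "Q = 0") (auto simp: Q order_divides order_mult)
  then show ?case
    using insert.hyps Q by (simp add: R_def[symmetric] mult.commute[of R] mult_dvd_mono)
qed simp

lemma degree_prod_linear_powers:
  "finite T \<Longrightarrow> degree (\<Prod>a\<in>T. [:- a, 1:] ^ n a :: 'k::field poly) = sum n T"
  by (subst degree_prod_eq_sum_degree) (auto simp: degree_power_eq)

section \<open>Vector fields tangent to an arrangement\<close>

lemma normal_linear [simp]:
  "normal H (u + v) = normal H u + normal H v" "normal H (fscale c v) = smult [:c:] (normal H v)"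
  by (simp_all add: normal_def fscale_def smult_add_right mult.commute algebra_simps)

lemma along_linear [simp]:
  "along H (u + v) = along H u + along H v" "along H (fscale c v) = smult [:c:] (along H v)"
  by (simp_all add: along_def fscale_def smult_add_right mult.commute algebra_simps)

lemma deg_le_normal: "v \<in> all_fields k \<Longrightarrow> deg_le k (normal H v)"
  by (simp add: all_fields_def normal_def deg_le_add deg_le_smult)

lemma deg_le_along: "v \<in> all_fields k \<Longrightarrow> deg_le k (along H v)"
  by (simp add: all_fields_def along_def deg_le_add deg_le_smult)

text \<open>Up to homogenization, these fields are the elements of degree \<open>k\<close> of \<open>D(cC)\<close> that annihilate
\<open>z\<close>, a complement of the multiples of the Euler derivation.\<close>

definition tangent_fields :: "('k::field ^ 2) set set \<Rightarrow> nat \<Rightarrow> ('k poly poly \<times> 'k poly poly) set" where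
  "tangent_fields C k = {v \<in> all_fields k. \<forall>H\<in>C. form H dvd normal H v}"

lemma subspace_tangent_fields: "fields.subspace (tangent_fields C k)"
  by (auto simp: fields.subspace_def tangent_fields_def all_fields_def deg_le_add dvd_smult)
    (auto simp: normal_def fscale_def deg_le_smult)

text \<open>The points of \<open>H\<close> as elements of the plane, which \<open>points_on_line\<close> keeps as singletons.\<close>

definition meeting_points :: "('k::field ^ 2) set set \<Rightarrow> ('k ^ 2) set \<Rightarrow> ('k ^ 2) set" where
  "meeting_points C H = {p \<in> H. \<exists>H'\<in>C. H' \<noteq> H \<and> p \<in> H'}"

lemma points_on_line_singletons:
  assumes "C \<subseteq> affine_lines" "H \<in> affine_lines"
  shows "points_on_line C H = (\<lambda>p. {p}) ` meeting_points C H"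
proof -
  have "H \<inter> H' = {p}" if "p \<in> H" "p \<in> H'" "H' \<in> C" "H' \<noteq> H" for p H'
    using point_on_two_lines_unique[of H H'] that assms by blast
  note single = this
  show ?thesis
  proof (intro equalityI subsetI)
    fix Z assume "Z \<in> points_on_line C H"
    then obtain H' p where "Z = H \<inter> H'" "H' \<in> C" "H' \<noteq> H" "p \<in> H" "p \<in> H'"
      by (auto simp: points_on_line_def)
    then show "Z \<in> (\<lambda>p. {p}) ` meeting_points C H"
      using single[of p H'] by (auto simp: meeting_points_def)
  next
    fix Z assume "Z \<in> (\<lambda>p. {p}) ` meeting_points C H"
    then obtain H' p where "Z = {p}" "H' \<in> C" "H' \<noteq> H" "p \<in> H" "p \<in> H'"
      by (auto simp: meeting_points_def)
    then show "Z \<in> points_on_line C H"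
      using single[of p H'] unfolding points_on_line_def by blast
  qed
qed

lemma num_points_eq_card_meeting:
  assumes "C \<subseteq> affine_lines" "H \<in> affine_lines"
  shows "num_points_on_line C H = card (meeting_points C H)"
  by (simp add: points_on_line_singletons[OF assms] card_image)

lemma finite_meeting_points:
  assumes "line_arrangement C" "H \<in> affine_lines"
  shows "finite (meeting_points C H)"
proof -
  have "finite (points_on_line C H)"
    using assms(1) by (auto simp: points_on_line_def line_arrangement_def)
  then have "finite ((\<lambda>p. {p}) ` meeting_points C H)"
    using assms by (subst points_on_line_singletons[symmetric]) (auto simp: line_arrangement_def)
  then show ?thesis by (rule finite_imageD) simp
qed

definition lines_through :: "('k::field ^ 2) set set \<Rightarrow> 'k ^ 2 \<Rightarrow> ('k ^ 2) set set" where
  "lines_through C p = {H \<in> C. p \<in> H}"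

text \<open>Every line of \<open>C\<close> either misses \<open>H\<close> or passes through exactly one of the points where \<open>C\<close> meets
\<open>H\<close>. The summands are written as multiplicity minus one because that is the order of vanishing
forced at such a point by the tangency to \<open>C\<close>.\<close>

lemma card_lines_by_meeting_point:
  assumes C: "line_arrangement C" and H: "H \<in> affine_lines" "H \<notin> C"
  shows "card C = card {H' \<in> C. H \<inter> H' = {}} +
      (\<Sum>p\<in>meeting_points C H. card (lines_through C p) - 1) + card (meeting_points C H)"
proof -
  let ?M = "meeting_points C H"
  have fin: "finite C" "finite ?M"
    using assms finite_meeting_points by (auto simp: line_arrangement_def)
  have "C = {H' \<in> C. H \<inter> H' = {}} \<union> (\<Union>p\<in>?M. lines_through C p)"
    using H by (auto simp: meeting_points_def lines_through_def)
  moreover have "card ({H' \<in> C. H \<inter> H' = {}} \<union> (\<Union>p\<in>?M. lines_through C p)) =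
      card {H' \<in> C. H \<inter> H' = {}} + card (\<Union>p\<in>?M. lines_through C p)"
    using fin by (intro card_Un_disjoint) (auto simp: lines_through_def meeting_points_def)
  moreover have "card (\<Union>p\<in>?M. lines_through C p) = (\<Sum>p\<in>?M. card (lines_through C p))"
  proof (rule card_UN_disjoint)
    show "\<forall>p\<in>?M. \<forall>q\<in>?M. p \<noteq> q \<longrightarrow> lines_through C p \<inter> lines_through C q = {}"
      using point_on_two_lines_unique[of H] C H
      by (auto simp: lines_through_def meeting_points_def line_arrangement_def)
  qed (use fin in \<open>auto simp: lines_through_def\<close>)
  moreover have "(\<Sum>p\<in>?M. card (lines_through C p)) = (\<Sum>p\<in>?M. (card (lines_through C p) - 1) + 1)"
  proof (intro sum.cong refl)
    fix p assume "p \<in> ?M"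
    then have "lines_through C p \<noteq> {}" by (auto simp: lines_through_def meeting_points_def)
    then have "card (lines_through C p) > 0"
      using fin by (simp add: card_gt_0_iff lines_through_def)
    then show "card (lines_through C p) = (card (lines_through C p) - 1) + 1" by simp
  qed
  ultimately show ?thesis by (simp add: sum_Suc)
qed

text \<open>Let \<open>m\<close> lines of \<open>C\<close> pass through \<open>p = (p1, p2)\<close>. The function
\<open>\<phi> = (x - p1) g - (y - p2) f\<close> is the determinant of the radial field at \<open>p\<close> and the given field.
Both are tangent to these lines, so their \<open>m\<close> equations divide \<open>\<phi>\<close>. On \<open>H\<close> the product of the
equations has a zero of order \<open>m\<close> at \<open>p\<close>, whereas \<open>\<phi>\<close> is the normal component of the field
times a function with a simple zero at \<open>p\<close>.\<close>

lemma normal_multiplicity_at_point: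
  fixes H :: "('k::field ^ 2) set"
  assumes C: "line_arrangement C" and H: "H \<in> affine_lines" "H \<notin> C" and p: "p \<in> H"
    and v: "v \<in> tangent_fields C k"
  shows "[:- param H p, 1:] ^ (card (lines_through C p) - 1) dvd restrict_to H (normal H v)"
proof (cases "lines_through C p = {}")
  case True
  then show ?thesis by simp
next
  case False
  define f g X Y \<phi> where "f = fst v" "g = snd v" "X = lin 1 0 (- p $ 1)" "Y = lin 0 1 (- p $ 2)"
    "\<phi> = X * g - Y * f"
  let ?L = "lines_through C p"
  have L: "?L \<subseteq> C" "finite ?L" using C by (auto simp: lines_through_def line_arrangement_def)
  have "form H' dvd \<phi>" if "H' \<in> ?L" for H'
  proof -
    have H': "H' \<in> affine_lines" "p \<in> H'" "form H' dvd normal H' v"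
      using that C v by (auto simp: lines_through_def line_arrangement_def tangent_fields_def)
    have "coeff_c H' = - coeff_a H' * p $ 1 - coeff_b H' * p $ 2"
      using H'(2)[unfolded on_line_iff[OF H'(1)]] by algebra
    then have e: "form H' = smult [:coeff_a H':] X + smult [:coeff_b H':] Y"
      by (simp add: form_def lin_def f_g_X_Y_\<phi>_def)
    have "smult [:coeff_a H':] \<phi> = form H' * g - Y * normal H' v"
      "smult [:coeff_b H':] \<phi> = X * normal H' v - form H' * f"
      by (simp_all add: e normal_def f_g_X_Y_\<phi>_def algebra_simps smult_add_right smult_diff_right)
    then have "form H' dvd smult [:coeff_a H':] \<phi>" "form H' dvd smult [:coeff_b H':] \<phi>"
      using H'(3) by (simp_all add: dvd_diff)
    then show ?thesis
      using frame_props(1)[OF H'(1)] by (auto simp: form_dvd_iff[OF H'(1)])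
  qed
  then have "prod form ?L dvd \<phi>" using C L by (intro prod_forms_dvd[of C])
  then have "restrict_to H (prod form ?L) dvd restrict_to H \<phi>" by (auto simp: dvd_def)
  note dvd1 = this
  have "restrict_to H \<phi> = [:- param H p, 1:] * restrict_to H (normal H v)"
  proof -
    have "restrict_to H X = smult (coeff_b H) [:- param H p, 1:]"
      "restrict_to H Y = smult (- coeff_a H) [:- param H p, 1:]"
      using param_point[OF H(1) p] by (simp_all add: restrict_to_def f_g_X_Y_\<phi>_def restr_lin)
    then show ?thesis
      by (simp add: f_g_X_Y_\<phi>_def(5) normal_def algebra_simps smult_add_right flip: f_g_X_Y_\<phi>_def(1,2))
  qed
  with dvd1 have dvd2: "restrict_to H (prod form ?L) dvd [:- param H p, 1:] * restrict_to H (normal H v)"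
    by simp
  have "[:- param H p, 1:] ^ card ?L dvd restrict_to H (prod form ?L)"
  proof -
    have "[:- param H p, 1:] dvd restrict_to H (form H')" if "H' \<in> ?L" for H'
    proof -
      have "H' \<in> affine_lines" "p \<in> H'"
        using that C by (auto simp: lines_through_def line_arrangement_def)
      then show ?thesis
        unfolding restrict_to_form_at_point[OF H(1) \<open>H' \<in> affine_lines\<close> p \<open>p \<in> H'\<close>]
        by (intro dvd_smult) simp
    qed
    then have "(\<Prod>H'\<in>?L. [:- param H p, 1:]) dvd (\<Prod>H'\<in>?L. restrict_to H (form H'))"
      by (rule prod_dvd_prod)
    then show ?thesis by simp
  qed
  from dvd_trans[OF this dvd2]
  have "[:- param H p, 1:] ^ card ?L dvd [:- param H p, 1:] * restrict_to H (normal H v)" .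
  moreover have "card ?L = Suc (card ?L - 1)"
    using False L by (simp add: card_gt_0_iff)
  ultimately have "[:- param H p, 1:] * [:- param H p, 1:] ^ (card ?L - 1)
      dvd [:- param H p, 1:] * restrict_to H (normal H v)"
    by (metis power_Suc)
  then show ?thesis by (subst (asm) dvd_mult_cancel_left) auto
qed

lemma degree_graded_form:
  assumes "H \<in> affine_lines"
  shows "degree (graded (form H)) = 1"
  unfolding form_def by (rule degree_graded_lin) (rule frame_props(1)[OF assms])

text \<open>The lines of \<open>C\<close> parallel to \<open>H\<close> have the same normal direction as \<open>H\<close>, so their equations
divide the normal component itself. On \<open>H\<close> these equations are constant, and only the
cofactor contributes to the degree. Projectively this is the vanishing at the point at infinity of
\<open>H\<close>.\<close>

lemma normal_degree_drop:
  fixes H :: "('k::field ^ 2) set"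
  assumes C: "line_arrangement C" and H: "H \<in> affine_lines" "H \<notin> C"
    and v: "v \<in> tangent_fields C k" and nz: "restrict_to H (normal H v) \<noteq> 0"
  shows "degree (restrict_to H (normal H v)) + card {H' \<in> C. H \<inter> H' = {}} \<le> k"
proof -
  let ?N = "{H' \<in> C. H \<inter> H' = {}}"
  have fin: "finite ?N" using C by (auto simp: line_arrangement_def)
  have par: "coeff_a H' * coeff_b H = coeff_b H' * coeff_a H" "H' \<in> affine_lines" if "H' \<in> ?N" for H'
    using that C H lines_disjoint_parallel by (auto simp: line_arrangement_def)
  have "form H' dvd normal H v" if "H' \<in> ?N" for H'
  proof -
    have H': "form H' dvd normal H' v" using that v by (auto simp: tangent_fields_def)
    have "coeff_a H * coeff_b H' = coeff_b H * coeff_a H'"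
      using par[OF that] by (simp add: mult.commute)
    with proportional_pairs[OF frame_props(1)[OF par(2)[OF that]], of "coeff_a H" "coeff_b H"]
    obtain l where "coeff_a H = l * coeff_a H'" "coeff_b H = l * coeff_b H'" by metis
    then have "normal H v = [:[:l:]:] * normal H' v"
      by (simp add: normal_def smult_add_right mult.commute)
    then show ?thesis using H' by (metis dvd_mult)
  qed
  then have "prod form ?N dvd normal H v" using C by (intro prod_forms_dvd[of C]) auto
  then obtain q where q: "normal H v = prod form ?N * q" by (auto simp: dvd_def)
  have q0: "q \<noteq> 0" using nz q by auto
  have forms: "form H' \<noteq> 0" "degree (graded (form H')) = 1" if "H' \<in> ?N" for H'
    using par(2)[OF that] by (simp_all add: form_nonzero degree_graded_form)
  have "deg_le k (prod form ?N * q)"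
    using v deg_le_normal q by (metis (no_types, lifting) mem_Collect_eq tangent_fields_def)
  then have "card ?N \<le> k" "deg_le (k - card ?N) q"
    using deg_le_mult_cancel[of k "prod form ?N" q] degree_graded_prod[OF fin, of form] forms fin q0
    by (simp_all add: prod_zero_iff)
  moreover have "degree (restrict_to H (prod form ?N)) = 0"
  proof -
    have "degree (restrict_to H (form H')) = 0" if "H' \<in> ?N" for H'
      using par(1)[OF that] by (simp add: restrict_to_def form_def restr_lin)
    then have "degree (\<Prod>H'\<in>?N. restrict_to H (form H')) \<le> (\<Sum>H'\<in>?N. 0)"
      using degree_prod_sum_le[OF fin, of "\<lambda>H'. restrict_to H (form H')"] by simp
    then show ?thesis by simp
  qed
  ultimately show ?thesis
    using degree_restr_le[of "k - card ?N" q "coeff_a H" "coeff_b H" "base_x H" "base_y H"]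
      degree_mult_le[of "restrict_to H (prod form ?N)" "restrict_to H q"] q
    by (simp add: restrict_to_def)
qed

text \<open>The forced zeros of the normal component on \<open>H\<close> and the degree drop caused by the
parallels of \<open>H\<close> together leave \<open>k + 1 - (card C - n\<^sub>H)\<close> free coefficients. Natural number
subtraction is intended: a negative difference means that the normal component vanishes.\<close>

lemma dim_tangent_delete:
  fixes H :: "('k::field ^ 2) set"
  assumes C: "line_arrangement C" and H: "H \<in> affine_lines" "H \<notin> C"
    and l: "fields.dim_le (tangent_fields (insert H C) k) l"
  shows "fields.dim_le (tangent_fields C k) (l + (k + 1 + card (meeting_points C H) - card C))"
proof -
  let ?M = "meeting_points C H" and ?t = "param H"
  define e where "e p = card (lines_through C p) - 1" for p
  define P where "P = (\<Prod>p\<in>?M. [:- ?t p, 1:] ^ e p)"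
  have fin: "finite ?M" using finite_meeting_points C H by blast
  have MH: "?M \<subseteq> H" by (auto simp: meeting_points_def)
  have inj: "inj_on ?t ?M" using param_inj[OF H(1)] MH inj_on_subset by blast
  \<comment> \<open>multiplicities are attached to points but are needed as a function of the parameter\<close>
  define e' where "e' = e \<circ> inv_into ?M ?t"
  have e': "e' (?t p) = e p" if "p \<in> ?M" for p
    using inj that by (simp add: e'_def)
  have P: "P = (\<Prod>a\<in>?t ` ?M. [:- a, 1:] ^ e' a)"
    unfolding P_def by (simp add: prod.reindex[OF inj] e')
  have degP: "degree P = sum e ?M"
    unfolding P using fin by (subst degree_prod_linear_powers) (simp_all add: sum.reindex[OF inj] e')
  have n: "card C = card {H' \<in> C. H \<inter> H' = {}} + degree P + card ?M"
    using card_lines_by_meeting_point[OF C H] by (simp add: degP e_def)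
  show ?thesis
  proof (rule fields.dim_le_of_kernel[where f = "\<lambda>v. restrict_to H (normal H v)" and P = P])
    show "P dvd restrict_to H (normal H v)" if "v \<in> tangent_fields C k" for v
      unfolding P using fin normal_multiplicity_at_point[OF C H _ that] MH e'
      by (intro prod_linear_powers_dvd) (auto simp: e_def)
    show "restrict_to H (normal H v) = 0 \<or> degree (restrict_to H (normal H v)) <
        degree P + (k + 1 + card ?M - card C)" if "v \<in> tangent_fields C k" for v
      using normal_degree_drop[OF C H that] n by linarith
    have "{v \<in> tangent_fields C k. restrict_to H (normal H v) = 0} = tangent_fields (insert H C) k"
      by (auto simp: tangent_fields_def form_dvd_iff[OF H(1)])
    then show "fields.dim_le {v \<in> tangent_fields C k. restrict_to H (normal H v) = 0} l"
      using l by simp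
  qed (simp_all add: subspace_tangent_fields)
qed

definition scale_field :: "'k::field poly poly \<Rightarrow> 'k poly poly \<times> 'k poly poly \<Rightarrow> 'k poly poly \<times> 'k poly poly" where
  "scale_field p v = (p * fst v, p * snd v)"

lemma normal_scale_field [simp]: "normal H (scale_field p v) = p * normal H v"
  by (simp add: normal_def scale_field_def algebra_simps)

lemma normal_along_zero:
  assumes H: "H \<in> affine_lines"
    and "restrict_to H (normal H v) = 0" "restrict_to H (along H v) = 0"
  shows "restrict_to H (fst v) = 0" "restrict_to H (snd v) = 0"
proof -
  let ?f = "restrict_to H (fst v)" and ?g = "restrict_to H (snd v)"
  have 1: "smult (coeff_a H) ?f + smult (coeff_b H) ?g = 0"
    "smult (dual_r H) ?f + smult (dual_s H) ?g = 0"
    using assms(2,3) by (simp_all add: normal_def along_def)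
  have one: "smult (coeff_a H * dual_s H - coeff_b H * dual_r H) p = p" for p
    using frame_props(4)[OF H] by simp
  have "smult (coeff_a H * dual_s H - coeff_b H * dual_r H) ?f =
      smult (dual_s H) (smult (coeff_a H) ?f + smult (coeff_b H) ?g)
      - smult (coeff_b H) (smult (dual_r H) ?f + smult (dual_s H) ?g)"
    by (simp add: algebra_simps smult_add_right smult_diff_left)
  then show "?f = 0" unfolding one 1 by simp
  have "smult (coeff_a H * dual_s H - coeff_b H * dual_r H) ?g =
      smult (coeff_a H) (smult (dual_r H) ?f + smult (dual_s H) ?g)
      - smult (dual_r H) (smult (coeff_a H) ?f + smult (coeff_b H) ?g)"
    by (simp add: algebra_simps smult_add_right smult_diff_left)
  then show "?g = 0" unfolding one 1 by simp
qed

text \<open>At the crossing the field is tangent to two directions at once.\<close>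

lemma tangent_field_vanishes_at_crossing:
  fixes H :: "('k::field ^ 2) set"
  assumes "H \<in> affine_lines" "H' \<in> affine_lines" "H \<noteq> H'" "p \<in> H" "p \<in> H'"
    and "form H dvd normal H v" "form H' dvd normal H' v"
  shows "poly (restrict_to H (fst v)) (param H p) = 0" "poly (restrict_to H (snd v)) (param H p) = 0"
proof -
  define f g where fg: "f = poly (restrict_to H (fst v)) (param H p)"
    "g = poly (restrict_to H (snd v)) (param H p)"
  obtain q where "normal H' v = form H' * q" using assms(7) by (auto simp: dvd_def)
  then have "poly (restrict_to H (normal H' v)) (param H p) = 0"
    using restrict_to_form_at_point[OF assms(1,2,4,5)] by simp
  moreover have "poly (restrict_to H (normal H v)) (param H p) = 0"
    using assms(6) unfolding form_dvd_iff[OF assms(1)] by simp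
  ultimately have "coeff_a H' * f + coeff_b H' * g = 0" "coeff_a H * f + coeff_b H * g = 0"
    by (simp_all add: normal_def fg)
  then have "(coeff_a H' * coeff_b H - coeff_b H' * coeff_a H) * f = 0"
    "(coeff_a H' * coeff_b H - coeff_b H' * coeff_a H) * g = 0"
    by algebra+
  then have "f = 0" "g = 0"
    using lines_meeting_not_parallel[OF assms(1-5)] by simp_all
  then show "poly (restrict_to H (fst v)) (param H p) = 0" "poly (restrict_to H (snd v)) (param H p) = 0"
    by (simp_all add: fg)
qed

text \<open>The component along \<open>H\<close> is a polynomial of degree at most \<open>k\<close> with a zero at every crossing on \<open>H\<close>.\<close>

lemma dim_tangent_kernel:
  fixes H :: "('k::field ^ 2) set"
  assumes C: "line_arrangement C" and H: "H \<in> affine_lines" "H \<notin> C"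
    and l: "fields.dim_le {v \<in> tangent_fields (insert H C) k. restrict_to H (along H v) = 0} l"
  shows "fields.dim_le (tangent_fields (insert H C) k) (l + (k + 1 - card (meeting_points C H)))"
proof -
  let ?M = "meeting_points C H" and ?t = "param H"
  define P where "P = (\<Prod>a\<in>?t ` ?M. [:- a, 1:] ^ 1)"
  have fin: "finite ?M" using finite_meeting_points C H by blast
  have MH: "?M \<subseteq> H" by (auto simp: meeting_points_def)
  have inj: "inj_on ?t ?M" using param_inj[OF H(1)] MH inj_on_subset by blast
  have degP: "degree P = card ?M"
    unfolding P_def using fin by (subst degree_prod_linear_powers) (simp_all add: card_image[OF inj])
  show ?thesis
  proof (rule fields.dim_le_of_kernel[where f = "\<lambda>v. restrict_to H (along H v)" and P = P])
    fix v assume v: "v \<in> tangent_fields (insert H C) k"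
    have "[:- ?t p, 1:] dvd restrict_to H (along H v)" if p: "p \<in> ?M" for p
    proof -
      obtain H' where "H' \<in> C" "H' \<noteq> H" "p \<in> H'" "p \<in> H"
        using p by (auto simp: meeting_points_def)
      then have "poly (restrict_to H (fst v)) (?t p) = 0" "poly (restrict_to H (snd v)) (?t p) = 0"
        using tangent_field_vanishes_at_crossing[of H H' p v] v H C
        by (auto simp: tangent_fields_def line_arrangement_def)
      then show ?thesis by (simp add: along_def poly_eq_0_iff_dvd[symmetric])
    qed
    then show "P dvd restrict_to H (along H v)"
      unfolding P_def using fin by (intro prod_linear_powers_dvd) auto
    have "degree (restrict_to H (along H v)) \<le> k"
      using v degree_restr_le deg_le_along
      by (metis (no_types, lifting) mem_Collect_eq restrict_to_def tangent_fields_def)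
    then show "restrict_to H (along H v) = 0 \<or>
        degree (restrict_to H (along H v)) < degree P + (k + 1 - card ?M)"
      unfolding degP by linarith
  qed (simp_all add: subspace_tangent_fields l)
qed

text \<open>A field tangent to \<open>H\<close> whose component along \<open>H\<close> vanishes is zero on \<open>H\<close>, hence divisible by
the equation of \<open>H\<close>. This equation is prime to those of the lines of \<open>C\<close>, so the quotient is still
tangent to \<open>C\<close>.\<close>

lemma along_kernel:
  fixes H :: "('k::field ^ 2) set"
  assumes C: "line_arrangement C" and H: "H \<in> affine_lines" "H \<notin> C"
    and v: "v \<in> tangent_fields (insert H C) k" "restrict_to H (along H v) = 0"
  shows "v = 0 \<or> (k > 0 \<and> v \<in> scale_field (form H) ` tangent_fields C (k - 1))"
proof -
  have "restrict_to H (normal H v) = 0"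
    using v(1) form_dvd_iff[OF H(1)] by (simp add: tangent_fields_def)
  then have "form H dvd fst v" "form H dvd snd v"
    using normal_along_zero[OF H(1)] v(2) form_dvd_iff[OF H(1)] by auto
  then obtain f g where fg: "fst v = form H * f" "snd v = form H * g" by (auto simp: dvd_def)
  then have v': "v = scale_field (form H) (f, g)" by (simp add: scale_field_def prod_eq_iff)
  have d: "deg_le k (form H * f)" "deg_le k (form H * g)"
    using v(1) fg by (auto simp: tangent_fields_def all_fields_def)
  have F: "form H \<noteq> 0" "degree (graded (form H)) = 1"
    using H(1) by (simp_all add: form_nonzero degree_graded_form)
  show ?thesis
  proof (cases "f = 0 \<and> g = 0")
    case True
    then show ?thesis by (simp add: v' scale_field_def zero_prod_def)
  next
    case False
    then have "k > 0" "deg_le (k - 1) f" "deg_le (k - 1) g"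
      using deg_le_mult_cancel[OF d(1) F(1)] deg_le_mult_cancel[OF d(2) F(1)] F(2)
      by (cases "f = 0"; cases "g = 0"; auto)+
    moreover have "form H' dvd normal H' (f, g)" if "H' \<in> C" for H'
    proof -
      have H': "H' \<in> affine_lines" "H' \<noteq> H" using that C H by (auto simp: line_arrangement_def)
      have "form H' dvd form H * normal H' (f, g)"
        using v(1) that by (auto simp: v' tangent_fields_def)
      then show ?thesis
        using prime_elem_dvd_multD[OF prime_form[OF H'(1)]] form_dvd_form_iff[OF H'(1) H(1)] H'(2)
        by blast
    qed
    ultimately show ?thesis
      by (auto simp: v' tangent_fields_def all_fields_def)
  qed
qed

lemma dim_along_kernel_0:
  fixes H :: "('k::field ^ 2) set"
  assumes C: "line_arrangement C" and H: "H \<in> affine_lines" "H \<notin> C"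
  shows "fields.dim_le {v \<in> tangent_fields (insert H C) 0. restrict_to H (along H v) = 0} 0"
  using along_kernel[OF C H, of _ 0] by (intro fields.dim_le_mono[OF fields.dim_le_zero]) auto

lemma dim_along_kernel_Suc:
  fixes H :: "('k::field ^ 2) set"
  assumes C: "line_arrangement C" and H: "H \<in> affine_lines" "H \<notin> C"
    and l: "fields.dim_le (tangent_fields C k) l"
  shows "fields.dim_le {v \<in> tangent_fields (insert H C) (Suc k). restrict_to H (along H v) = 0} l"
proof -
  have "0 \<in> tangent_fields C k" using subspace_tangent_fields fields.subspace_0 by blast
  moreover have "scale_field (form H) 0 = 0" by (simp add: scale_field_def zero_prod_def)
  ultimately have "0 \<in> scale_field (form H) ` tangent_fields C k" by (metis imageI)
  then have "{v \<in> tangent_fields (insert H C) (Suc k). restrict_to H (along H v) = 0}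
      \<subseteq> scale_field (form H) ` tangent_fields C k"
    using along_kernel[OF C H, of _ "Suc k"] by fastforce
  moreover have "fields.dim_le (scale_field (form H) ` tangent_fields C k) l"
    by (rule fields.dim_le_image[OF l]) (auto simp: scale_field_def fscale_def algebra_simps)
  ultimately show ?thesis using fields.dim_le_mono by blast
qed

section \<open>The characteristic polynomial of a line arrangement\<close>

definition crossings :: "('k::field ^ 2) set set \<Rightarrow> ('k ^ 2) set" where
  "crossings C = {p. \<exists>H\<in>C. p \<in> meeting_points C H}"

text \<open>The sum \<open>excess C\<close> is the sum of the values of the Moebius function over the points of the
intersection poset, that is, the second Betti number of the arrangement.\<close>

definition excess :: "('k::field ^ 2) set set \<Rightarrow> nat" where
  "excess C = (\<Sum>p\<in>crossings C. card (lines_through C p) - 1)"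

lemma finite_crossings:
  assumes "line_arrangement C"
  shows "finite (crossings C)"
proof -
  have "crossings C = (\<Union>H\<in>C. meeting_points C H)" by (auto simp: crossings_def)
  moreover have "finite C" "C \<subseteq> affine_lines" using assms by (auto simp: line_arrangement_def)
  ultimately show ?thesis
    using finite_meeting_points[OF assms] by auto
qed

lemma card_lines_through_pos:
  assumes "finite C" "p \<in> meeting_points C H"
  shows "card (lines_through C p) > 0"
proof -
  have "lines_through C p \<noteq> {}" using assms(2) by (auto simp: meeting_points_def lines_through_def)
  then show ?thesis using assms(1) by (simp add: card_gt_0_iff lines_through_def)
qed

text \<open>The new line adds \<open>1\<close> to the summand of each point where it meets \<open>C\<close>: such a point is either new,
with two lines, or gains one line.\<close>

lemma excess_insert:
  fixes H :: "('k::field ^ 2) set"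
  assumes C: "line_arrangement C" and H: "H \<in> affine_lines" "H \<notin> C"
  shows "excess (insert H C) = excess C + card (meeting_points C H)"
proof -
  let ?T = "crossings (insert H C)" and ?M = "meeting_points C H"
  have fC: "finite C" using C by (simp add: line_arrangement_def)
  have "line_arrangement (insert H C)" using C H by (simp add: line_arrangement_def)
  then have fT: "finite ?T" by (rule finite_crossings)
  have M: "?M \<subseteq> ?T" by (auto simp: crossings_def meeting_points_def)
  have "card (lines_through C p) \<le> 1" if "p \<notin> crossings C" for p
  proof -
    have "H1 = H2" if "H1 \<in> lines_through C p" "H2 \<in> lines_through C p" for H1 H2
      using that \<open>p \<notin> crossings C\<close> by (auto simp: crossings_def meeting_points_def lines_through_def)
    then show ?thesis using card_le_Suc0_iff_eq[of "lines_through C p"] fC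
      by (auto simp: lines_through_def)
  qed
  then have out: "\<forall>p\<in>?T - crossings C. card (lines_through C p) - 1 = 0"
    by (metis DiffD2 diff_is_0_eq)
  have "crossings C \<subseteq> ?T" by (auto simp: crossings_def meeting_points_def)
  then have "excess C = (\<Sum>p\<in>?T. card (lines_through C p) - 1)"
    unfolding excess_def by (rule sum.mono_neutral_left[OF fT _ out])
  moreover have "card (lines_through (insert H C) p) - 1
      = (card (lines_through C p) - 1) + (if p \<in> ?M then 1 else 0)" if "p \<in> ?T" for p
  proof (cases "p \<in> H")
    case True
    then have "p \<in> ?M" using that by (auto simp: crossings_def meeting_points_def)
    moreover have "lines_through (insert H C) p = insert H (lines_through C p)"
      using True by (auto simp: lines_through_def)
    moreover have "H \<notin> lines_through C p" "finite (lines_through C p)"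
      using H fC by (auto simp: lines_through_def)
    ultimately show ?thesis using card_lines_through_pos[OF fC] by fastforce
  next
    case False
    then have "lines_through (insert H C) p = lines_through C p" "p \<notin> ?M"
      by (auto simp: lines_through_def meeting_points_def)
    then show ?thesis by simp
  qed
  moreover have "(\<Sum>p\<in>?T. if p \<in> ?M then 1 else 0) = card ?M"
    using fT M by (simp add: sum.If_cases Int_absorb1)
  ultimately show ?thesis
    unfolding excess_def[of "insert H C"] by (simp add: sum.distrib)
qed

lemma affine_line_two_points:
  fixes H :: "('k::field ^ 2) set"
  assumes "H \<in> affine_lines"
  obtains p q where "p \<in> H" "q \<in> H" "p \<noteq> q"
proof -
  define p q :: "'k ^ 2" where "p = vector [base_x H, base_y H]"
    "q = vector [base_x H + coeff_b H, base_y H - coeff_a H]"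
  have "p \<in> H" "q \<in> H"
    using frame_props(3)[OF assms] by (simp_all add: on_line_iff[OF assms] p_q_def algebra_simps)
  moreover have "p $ 1 \<noteq> q $ 1 \<or> p $ 2 \<noteq> q $ 2"
    using frame_props(1)[OF assms] by (auto simp: p_q_def)
  then have "p \<noteq> q" by auto
  ultimately show ?thesis using that by blast
qed

lemma affine_line_not_UNIV:
  fixes H :: "('k::field ^ 2) set"
  assumes "H \<in> affine_lines"
  shows "H \<noteq> UNIV"
proof -
  define p :: "'k ^ 2" where "p = vector [base_x H + dual_s H, base_y H - dual_r H]"
  have "coeff_a H * p $ 1 + coeff_b H * p $ 2 + coeff_c H = 1"
    using frame_props(3,4)[OF assms] unfolding p_def vector_2 by algebra
  then have "p \<notin> H" by (simp add: on_line_iff[OF assms])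
  then show ?thesis by auto
qed

lemma affine_line_subset_eq:
  assumes "H \<in> affine_lines" "H' \<in> affine_lines" "H \<subseteq> H'"
  shows "H = H'"
  using affine_line_two_points[OF assms(1)] point_on_two_lines_unique[OF assms(1,2)] assms(3)
  by (metis subsetD)

lemma intersection_poset_lines:
  assumes "C \<subseteq> affine_lines"
  shows "intersection_poset C = insert UNIV (C \<union> (\<lambda>p. {p}) ` crossings C)"
proof (intro equalityI subsetI)
  fix X assume "X \<in> intersection_poset C"
  then obtain B where B: "B \<subseteq> C" "X = \<Inter> B" "X \<noteq> {}" by (auto simp: intersection_poset_def)
  consider "B = {}" | H where "B = {H}" | H H' where "H \<in> B" "H' \<in> B" "H' \<noteq> H"
    by auto
  then show "X \<in> insert UNIV (C \<union> (\<lambda>p. {p}) ` crossings C)"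
  proof cases
    case 3
    obtain p where p: "p \<in> X" using B by auto
    have H: "H \<in> affine_lines" "H' \<in> affine_lines" "p \<in> H" "p \<in> H'" using 3 B assms p by auto
    have "X \<subseteq> {p}"
      using point_on_two_lines_unique[OF H(1,2) 3(3)[symmetric] _ _ H(3,4)] 3 B by auto
    then have "X = {p}" using p by auto
    moreover have "p \<in> crossings C"
      using 3 B H by (auto simp: crossings_def meeting_points_def)
    ultimately show ?thesis by auto
  qed (use B in auto)
next
  fix X assume "X \<in> insert UNIV (C \<union> (\<lambda>p. {p}) ` crossings C)"
  then consider "X = UNIV" | "X \<in> C" | p where "X = {p}" "p \<in> crossings C" by auto
  then show "X \<in> intersection_poset C"
  proof cases
    case 1
    then show ?thesis unfolding intersection_poset_def by (intro CollectI exI[of _ "{}"]) auto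
  next
    case 2
    then have "X \<noteq> {}" using affine_line_two_points[of X] assms by blast
    then show ?thesis using 2 unfolding intersection_poset_def by (intro CollectI exI[of _ "{X}"]) auto
  next
    case 3
    then obtain H H' where H: "H \<in> C" "H' \<in> C" "H' \<noteq> H" "p \<in> H" "p \<in> H'"
      by (auto simp: crossings_def meeting_points_def)
    have "H \<inter> H' = {p}"
      using point_on_two_lines_unique[of H H'] H assms by blast
    then show ?thesis using H 3 unfolding intersection_poset_def
      by (intro CollectI exI[of _ "{H, H'}"]) auto
  qed
qed

lemma moebius_UNIV: "moebius C UNIV = 1"
  by (simp add: moebius.simps)

lemma moebius_line:
  assumes "line_arrangement C" "H \<in> C"
  shows "moebius C H = - 1"
proof -
  have C: "finite C" "C \<subseteq> affine_lines" "H \<in> affine_lines" using assms by (auto simp: line_arrangement_def)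
  have "\<not> H \<subset> {p}" for p
    using affine_line_two_points[OF C(3)] by (metis psubset_imp_subset singletonD subsetD)
  moreover have "\<not> H \<subset> H'" if "H' \<in> C" for H'
    using affine_line_subset_eq[OF C(3), of H'] that C by blast
  ultimately have "{Y \<in> intersection_poset C. H \<subset> Y} = {UNIV}"
    using affine_line_not_UNIV[OF C(3)] by (auto simp: intersection_poset_lines[OF C(2)])
  then show ?thesis
    using C affine_line_not_UNIV[OF C(3)] by (subst moebius.simps) (simp add: moebius_UNIV)
qed

lemma moebius_point:
  fixes p :: "'k::field ^ 2"
  assumes "line_arrangement C"
  shows "moebius C {p} = int (card (lines_through C p)) - 1"
proof -
  have C: "finite C" "C \<subseteq> affine_lines" using assms by (auto simp: line_arrangement_def)
  have ne: "{p} \<noteq> H" if "H \<in> affine_lines" for H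
    using affine_line_two_points[OF that] by (metis singletonD)
  have U: "(UNIV :: ('k ^ 2) set) \<noteq> {p}"
  proof
    assume u: "(UNIV :: ('k ^ 2) set) = {p}"
    have "(0 :: 'k ^ 2) \<noteq> vector [1, 1]" by (metis vector_2(1) zero_index zero_neq_one)
    then show False using u by (metis UNIV_I singletonD)
  qed
  have "{Y \<in> intersection_poset C. {p} \<subset> Y} = insert UNIV (lines_through C p)"
    using ne C U by (auto simp: intersection_poset_lines[OF C(2)] lines_through_def)
  moreover have "UNIV \<notin> lines_through C p"
    using affine_line_not_UNIV C by (auto simp: lines_through_def)
  moreover have "finite (lines_through C p)" using C by (simp add: lines_through_def)
  moreover have "(\<Sum>H\<in>lines_through C p. moebius C H) = (\<Sum>H\<in>lines_through C p. - 1)"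
    using moebius_line[OF assms] by (intro sum.cong) (auto simp: lines_through_def)
  ultimately show ?thesis
    using C U by (subst moebius.simps) (simp add: moebius_UNIV)
qed

lemma affine_subspace_dim_UNIV: "affine_subspace_dim (UNIV :: ('k::field ^ 2) set) = 2"
proof -
  have eq: "{u - v | u v. u \<in> UNIV \<and> v \<in> UNIV} = (UNIV :: ('k ^ 2) set)"
  proof (intro equalityI subsetI CollectI)
    fix w :: "'k ^ 2"
    show "\<exists>u v. w = u - v \<and> u \<in> UNIV \<and> v \<in> UNIV"
      by (intro exI[of _ w] exI[of _ 0]) simp
  qed simp
  show ?thesis
    unfolding affine_subspace_dim_def eq vec.dim_UNIV card_cart_basis by simp
qed

lemma affine_subspace_dim_point: "affine_subspace_dim {p} = 0"
  by (simp add: affine_subspace_dim_def vec.dim_eq_0)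

lemma affine_subspace_dim_line:
  fixes H :: "('k::field ^ 2) set"
  assumes "H \<in> affine_lines"
  shows "affine_subspace_dim H = 1"
proof -
  obtain p q where pq: "p \<in> H" "q \<in> H" "p \<noteq> q" using affine_line_two_points[OF assms] .
  define d :: "'k ^ 2" where "d = vector [coeff_b H, - coeff_a H]"
  have sub: "u - v = (param H u - param H v) *s d" if "u \<in> H" "v \<in> H" for u v
    using param_point[OF assms that(1)] param_point[OF assms that(2)]
    by (simp add: d_def vec_eq_iff forall_2 algebra_simps)
  have "vec.dim {u - v | u v. u \<in> H \<and> v \<in> H} = vec.dim {p - q}"
  proof (rule vec.dim_unique[THEN trans])
    show "{p - q} \<subseteq> {u - v | u v. u \<in> H \<and> v \<in> H}" using pq by auto
    show "vec.independent {p - q}" using pq by simp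
    have nz: "param H p - param H q \<noteq> 0"
      using param_inj[OF assms] pq by (auto simp: inj_on_def)
    have "u - v \<in> vec.span {p - q}" if "u \<in> H" "v \<in> H" for u v
    proof -
      have "u - v = ((param H u - param H v) / (param H p - param H q)) *s (p - q)"
        unfolding sub[OF that] sub[OF pq(1,2)] using nz by simp
      then show ?thesis by (simp add: vec.span_scale vec.span_base)
    qed
    then show "{u - v | u v. u \<in> H \<and> v \<in> H} \<subseteq> vec.span {p - q}" by auto
  qed (use pq in auto)
  then show ?thesis using pq by (simp add: affine_subspace_dim_def)
qed

text \<open>The intersection poset consists of the plane, the lines and the crossings, with Moebius values \<open>1\<close>,
\<open>- 1\<close> and (number of lines through the point) minus \<open>1\<close>.\<close>

lemma characteristic_poly_lines:
  fixes C :: "('k::field ^ 2) set set"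
  assumes C: "line_arrangement C"
  shows "characteristic_poly C = [:int (excess C), - int (card C), 1:]"
proof -
  let ?t = "\<lambda>X. monom (moebius C X) (affine_subspace_dim X)"
  have C': "finite C" "C \<subseteq> affine_lines" using C by (auto simp: line_arrangement_def)
  have U: "UNIV \<notin> C" using affine_line_not_UNIV C' by blast
  have dis: "C \<inter> (\<lambda>p. {p}) ` crossings C = {}"
  proof (rule ccontr)
    assume "\<not> ?thesis"
    then obtain p where "{p} \<in> C" by auto
    then have "{p} \<in> affine_lines" using C' by auto
    then show False using affine_line_two_points[of "{p}"] by auto
  qed
  have U2: "UNIV \<notin> (\<lambda>p :: 'k ^ 2. {p}) ` crossings C"
  proof
    assume "UNIV \<in> (\<lambda>p :: 'k ^ 2. {p}) ` crossings C"
    then obtain p :: "'k ^ 2" where "UNIV = {p}" by auto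
    then show False
      using affine_subspace_dim_UNIV[where 'k = 'k] affine_subspace_dim_point[of p] by simp
  qed
  have "characteristic_poly C = ?t UNIV + ((\<Sum>H\<in>C. ?t H) + (\<Sum>X\<in>(\<lambda>p. {p}) ` crossings C. ?t X))"
    unfolding characteristic_poly_def intersection_poset_lines[OF C'(2)]
    using C' finite_crossings[OF C] U U2 dis
    by (subst sum.insert) (auto simp: sum.union_disjoint)
  moreover have "(\<Sum>H\<in>C. ?t H) = (\<Sum>H\<in>C. monom (- 1) 1)"
    using C'(2) by (intro sum.cong) (auto simp: moebius_line[OF C] affine_subspace_dim_line)
  moreover have "(\<Sum>X\<in>(\<lambda>p. {p}) ` crossings C. ?t X)
      = (\<Sum>p\<in>crossings C. [:int (card (lines_through C p) - 1):])"
  proof -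
    have "int (card (lines_through C p)) - 1 = int (card (lines_through C p) - 1)"
      if "p \<in> crossings C" for p
      using that card_lines_through_pos[OF C'(1)] by (fastforce simp: crossings_def)
    then show ?thesis
      by (subst sum.reindex)
        (auto simp: moebius_point[OF C] affine_subspace_dim_point monom_0 intro!: sum.cong)
  qed
  moreover have "(\<Sum>p\<in>A. [:int (f p):]) = [:int (\<Sum>p\<in>A. f p):]" for f and A :: "('k ^ 2) set"
    by (induction A rule: infinite_finite_induct) auto
  ultimately show ?thesis
    by (simp add: moebius_UNIV affine_subspace_dim_UNIV excess_def)
      (simp add: poly_eq_iff coeff_pCons of_nat_poly split: nat.splits)
qed

section \<open>Comparing the two dimension bounds\<close>

text \<open>The sum over the degrees \<open>j < k\<close> of the numbers of conditions imposed by the two restrictions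
to \<open>H\<close>. It is the dimension of \<open>tangent_fields C (k - 1)\<close> for an arrangement that is free with
exponents \<open>d1, d2\<close>; the shift by one makes it zero at \<open>k = 0\<close>.\<close>

definition free_dim :: "nat \<Rightarrow> nat \<Rightarrow> nat \<Rightarrow> nat" where
  "free_dim d1 d2 k = (\<Sum>j<k. (j + 1 - d1) + (j + 1 - d2))"

lemma free_dim_Suc:
  "free_dim d1 d2 (Suc k) = free_dim d1 d2 k + (k + 1 - d1) + (k + 1 - d2)"
  by (simp add: free_dim_def)

lemma free_dim_closed:
  assumes "d1 \<le> k" "d2 \<le> k"
  shows "2 * int (free_dim d1 d2 k) =
    (int k - int d1) * (int k - int d1 + 1) + (int k - int d2) * (int k - int d2 + 1)"
proof -
  have "2 * int (\<Sum>j<k. j + 1 - d) = (int k - int d) * (int k - int d + 1)" if "d \<le> k" for d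
    using that
  proof (induction k rule: dec_induct)
    case base
    have "(\<Sum>j<d. j + 1 - d) = 0" by (intro sum.neutral) auto
    then show ?case by simp
  next
    case (step k)
    then have "int (k + 1 - d) = int k + 1 - int d" by simp
    then show ?case using step by (simp add: algebra_simps)
  qed
  from this[OF assms(1)] this[OF assms(2)] show ?thesis
    unfolding free_dim_def sum.distrib of_nat_add distrib_left by (simp only:)
qed

text \<open>The numbers \<open>d1, d2\<close> are the exponents that \<open>C\<close> has if it is free with an exponent equal to
the number of its points on \<open>H\<close>.\<close>

locale line_off_arrangement =
  fixes C :: "('k::field ^ 2) set set" and H :: "('k ^ 2) set" and d1 d2 :: nat
  assumes C: "line_arrangement C" and H: "H \<in> affine_lines" "H \<notin> C"
    and d2: "d2 = card (meeting_points C H)" and sum_d: "d1 + d2 = card C"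
begin

lemma dim_delete_step:
  assumes "fields.dim_le (tangent_fields (insert H C) k) l"
  shows "fields.dim_le (tangent_fields C k) (l + (k + 1 - d1))"
proof -
  have "k + 1 + card (meeting_points C H) - card C = k + 1 - d1" using sum_d d2 by linarith
  then show ?thesis using dim_tangent_delete[OF C H assms] by simp
qed

lemma dim_kernel_step:
  assumes "fields.dim_le {v \<in> tangent_fields (insert H C) k. restrict_to H (along H v) = 0} l"
  shows "fields.dim_le (tangent_fields (insert H C) k) (l + (k + 1 - d2))"
  using dim_tangent_kernel[OF C H assms] d2 by simp

lemma dim_Suc_step:
  assumes "fields.dim_le (tangent_fields C k) l"
  shows "fields.dim_le (tangent_fields C (Suc k)) (l + (Suc k + 1 - d2) + (Suc k + 1 - d1))"
  by (intro dim_delete_step dim_kernel_step dim_along_kernel_Suc C H assms)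

lemma dim_tangent_le_free_dim:
  "fields.dim_le {v \<in> tangent_fields (insert H C) k. restrict_to H (along H v) = 0} (free_dim d1 d2 k)"
  "fields.dim_le (tangent_fields C k) (free_dim d1 d2 (Suc k))"
proof -
  have *: "fields.dim_le (tangent_fields C k) (free_dim d1 d2 (Suc k))"
    if "fields.dim_le {v \<in> tangent_fields (insert H C) k. restrict_to H (along H v) = 0} (free_dim d1 d2 k)" for k
    using dim_delete_step[OF dim_kernel_step[OF that]] by (simp add: free_dim_Suc algebra_simps)
  show "fields.dim_le {v \<in> tangent_fields (insert H C) k. restrict_to H (along H v) = 0} (free_dim d1 d2 k)"
  proof (induction k)
    case 0
    show ?case using dim_along_kernel_0[OF C H] by (simp add: free_dim_def)
  next
    case (Suc k)
    show ?case by (intro dim_along_kernel_Suc C H * Suc)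
  qed
  then show "fields.dim_le (tangent_fields C k) (free_dim d1 d2 (Suc k))" by (rule *)
qed

end

lemma card_meeting_le:
  assumes "line_arrangement C" "H \<in> affine_lines" "H \<notin> C"
  shows "card (meeting_points C H) \<le> card C"
  using card_lines_by_meeting_point[OF assms] by simp

text \<open>Dropping all lines of \<open>C\<close> one by one leads from \<open>tangent_fields C k\<close> to the space of all fields of
degree at most \<open>k\<close>, whose dimension is \<open>(k + 1) (k + 2)\<close>. The line dropped to leave \<open>i\<close>
lines, on which they have \<open>e\<close> points, costs \<open>k + 1 + e - i\<close> dimensions, and by
\<open>excess_insert\<close> the numbers \<open>e\<close> add up to \<open>excess C\<close>. The hypothesis
\<open>card C \<le> k\<close> makes all these differences honest; the inequality is doubled to avoid division.\<close>

lemma dim_tangent_lower_bound: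
  fixes C :: "('k::field ^ 2) set set"
  assumes "line_arrangement C" "card C \<le> k" "fields.dim_le (tangent_fields C k) m"
  shows "2 * (int k + 1) * (int k + 2) + int (card C) * (int (card C) - 1)
      \<le> 2 * int m + 2 * int (card C) * (int k + 1) + 2 * int (excess C)"
proof -
  have "finite C" using assms by (simp add: line_arrangement_def)
  then show ?thesis using assms
  proof (induction C arbitrary: m rule: finite_induct)
    case empty
    have "tangent_fields {} k = (all_fields k :: ('k poly poly \<times> 'k poly poly) set)" by (auto simp: tangent_fields_def)
    with empty have "(k + 1) * (k + 2) \<le> m" by (intro all_fields_dim) simp
    then have "int ((k + 1) * (k + 2)) \<le> int m" by linarith
    then show ?case by (simp add: algebra_simps)
  next
    case (insert H C)
    let ?n = "card C" and ?e = "card (meeting_points C H)"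
    have C: "line_arrangement C" "H \<in> affine_lines" using insert by (auto simp: line_arrangement_def)
    have n: "card (insert H C) = ?n + 1" using insert by simp
    have le: "?e \<le> ?n" by (rule card_meeting_le[OF C insert(2)])
    have kn: "?n \<le> k" using insert n by simp
    have m': "int (m + (k + 1 + ?e - ?n)) = int m + int k + 1 + int ?e - int ?n"
      using kn by simp
    from insert.IH[OF C(1) kn dim_tangent_delete[OF C insert(2) insert.prems(3)]]
    show ?case
      unfolding n m' excess_insert[OF C insert(2)]
      by (simp add: algebra_simps)
  qed
qed

context line_off_arrangement
begin

text \<open>If the dimension in one degree falls short of the free one by \<open>\<delta>\<close>, it does so in all higher
degrees, since every further step adds at most the same number of dimensions to both.\<close>

lemma dim_defect_persists:
  assumes "fields.dim_le (tangent_fields C k) l" "l + \<delta> \<le> free_dim d1 d2 (Suc k)"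
  shows "\<exists>l'. fields.dim_le (tangent_fields C (k + j)) l' \<and> l' + \<delta> \<le> free_dim d1 d2 (Suc (k + j))"
proof (induction j)
  case 0
  then show ?case using assms by auto
next
  case (Suc j)
  then obtain l' where l': "fields.dim_le (tangent_fields C (k + j)) l'"
    "l' + \<delta> \<le> free_dim d1 d2 (Suc (k + j))" by auto
  show ?case
    using dim_Suc_step[OF l'(1)] l'(2)
    by (intro exI[of _ "l' + (Suc (k + j) + 1 - d2) + (Suc (k + j) + 1 - d1)"])
      (simp add: free_dim_Suc)
qed

text \<open>In a large degree the lower bound on \<open>tangent_fields C K\<close> and the upper bound, improved by \<open>\<delta>\<close>, are
quadratic polynomials in \<open>K\<close> that differ only in their constant terms. The comparison of these is the
claim. The version with \<open>\<delta> = 1\<close> shows that a strict inequality anywhere in the chain excludes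
\<open>excess C = d1 * d2\<close>.\<close>

lemma excess_ge_with_defect:
  assumes "fields.dim_le (tangent_fields C k) l" "l + \<delta> \<le> free_dim d1 d2 (Suc k)"
  shows "d1 * d2 + \<delta> \<le> excess C"
proof -
  define K where "K = k + card C"
  obtain l' where l': "fields.dim_le (tangent_fields C K) l'" "l' + \<delta> \<le> free_dim d1 d2 (Suc K)"
    using dim_defect_persists[OF assms] unfolding K_def by blast
  have "2 * (int K + 1) * (int K + 2) + int (card C) * (int (card C) - 1)
      \<le> 2 * int l' + 2 * int (card C) * (int K + 1) + 2 * int (excess C)"
    by (rule dim_tangent_lower_bound[OF C _ l'(1)]) (simp add: K_def)
  moreover have "2 * int l' + 2 * int \<delta> \<le> 2 * int (free_dim d1 d2 (Suc K))"
    using l'(2) by linarith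
  moreover have "2 * int (free_dim d1 d2 (Suc K)) =
      (int K + 1 - int d1) * (int K + 1 - int d1 + 1) + (int K + 1 - int d2) * (int K + 1 - int d2 + 1)"
    using sum_d free_dim_closed[of d1 "Suc K" d2] by (simp add: K_def algebra_simps)
  moreover have "int (card C) = int d1 + int d2" using sum_d by simp
  ultimately have "int d1 * int d2 + int \<delta> \<le> int (excess C)"
    by (simp add: algebra_simps)
  then show ?thesis by (metis of_nat_add of_nat_le_iff of_nat_mult)
qed

lemma excess_ge: "d1 * d2 \<le> excess C"
  using excess_ge_with_defect[OF dim_tangent_le_free_dim(2), of 0 0] by simp

text \<open>If every field of degree \<open>d1\<close> tangent to \<open>C\<close> were tangent to \<open>H\<close>, the restriction of the normal
component would cost nothing in degree \<open>k = d1\<close>, where the upper bound allows it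
\<open>k + 1 - d1 = 1\<close> dimension: a defect of one would result.\<close>

lemma ex_transversal_field:
  assumes "excess C = d1 * d2"
  obtains v where "v \<in> tangent_fields C d1" "restrict_to H (normal H v) \<noteq> 0"
proof (rule ccontr)
  assume "\<not> thesis"
  then have "tangent_fields C d1 \<subseteq> tangent_fields (insert H C) d1"
    using that form_dvd_iff[OF H(1)] by (auto simp: tangent_fields_def)
  then have "fields.dim_le (tangent_fields C d1) (free_dim d1 d2 d1 + (d1 + 1 - d2))"
    using dim_kernel_step[OF dim_tangent_le_free_dim(1)] fields.dim_le_mono by blast
  then have "d1 * d2 + 1 \<le> excess C"
    by (rule excess_ge_with_defect) (simp add: free_dim_Suc)
  then show False using assms by simp
qed

text \<open>The same argument for the component along \<open>H\<close>, in degree \<open>k = d2\<close>, where the upper bound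
allows it \<open>k + 1 - d2 = 1\<close> dimension.\<close>

lemma ex_along_field:
  assumes "excess C = d1 * d2"
  obtains v where "v \<in> tangent_fields (insert H C) d2" "restrict_to H (along H v) \<noteq> 0"
proof (rule ccontr)
  assume "\<not> thesis"
  then have "tangent_fields (insert H C) d2
      = {v \<in> tangent_fields (insert H C) d2. restrict_to H (along H v) = 0}"
    using that by auto
  then have "fields.dim_le (tangent_fields C d2) (free_dim d1 d2 d2 + (d2 + 1 - d1))"
    using dim_delete_step dim_tangent_le_free_dim(1)[of d2] by simp
  then have "d1 * d2 + 1 \<le> excess C"
    by (rule excess_ge_with_defect) (simp add: free_dim_Suc)
  then show False using assms by simp
qed

end

section \<open>The determinant and homogenization\<close>

definition field_det :: "'a::comm_ring_1 \<times> 'a \<Rightarrow> 'a \<times> 'a \<Rightarrow> 'a" where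
  "field_det u v = fst u * snd v - snd u * fst v"

text \<open>The components of a field normal to and along \<open>H\<close> arise by a linear change of coordinates of
determinant \<open>1\<close>. In these coordinates, both the divisibility of the determinant by the equation of
\<open>H\<close> and its value on \<open>H\<close> can be read off.\<close>

lemma field_det_normal_along:
  assumes "H \<in> affine_lines"
  shows "field_det u v = normal H u * along H v - along H u * normal H v"
proof -
  define a b r s where abrs: "a = [:[:coeff_a H:]:]" "b = [:[:coeff_b H:]:]"
    "r = [:[:dual_r H:]:]" "s = [:[:dual_s H:]:]"
  have "a * s - b * r = 1"
    using frame_props(4)[OF assms] by (simp add: abrs one_pCons mult.commute)
  then have "f * g' - g * f' = (a * f + b * g) * (r * f' + s * g') - (r * f + s * g) * (a * f' + b * g')"
    for f g f' g' by algebra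
  moreover have "normal H w = a * fst w + b * snd w" "along H w = r * fst w + s * snd w" for w
    by (simp_all add: normal_def along_def abrs)
  ultimately show ?thesis unfolding field_det_def by presburger
qed

lemma prod_forms_dvd_det:
  assumes C: "line_arrangement C" and "u \<in> tangent_fields C k" "v \<in> tangent_fields C l"
  shows "prod form C dvd field_det u v"
proof (rule prod_forms_dvd[OF C])
  fix H assume "H \<in> C"
  then have "H \<in> affine_lines" "form H dvd normal H u" "form H dvd normal H v"
    using assms by (auto simp: line_arrangement_def tangent_fields_def)
  then show "form H dvd field_det u v"
    by (simp add: field_det_normal_along dvd_diff)
qed simp

text \<open>The equations of the lines are pairwise non-associated primes dividing the determinant, and the degrees leave
room for a constant cofactor only.\<close>

lemma det_eq_const_prod_forms:
  fixes C :: "('k::field ^ 2) set set"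
  assumes C: "line_arrangement C" and uv: "u \<in> tangent_fields C d1" "v \<in> tangent_fields C d2"
    and sum_d: "d1 + d2 = card C" and nz: "field_det u v \<noteq> 0"
  obtains c where "c \<noteq> 0" "field_det u v = smult [:c:] (prod form C)"
proof -
  obtain q where q: "field_det u v = prod form C * q"
    using prod_forms_dvd_det[OF C uv] by (auto simp: dvd_def)
  have fin: "finite C" and lines: "\<And>H. H \<in> C \<Longrightarrow> H \<in> affine_lines"
    using C by (auto simp: line_arrangement_def)
  have "degree (graded (prod form C)) = card C"
    using degree_graded_prod[OF fin, of form] lines by (simp add: form_nonzero degree_graded_form)
  moreover have "deg_le (card C) (prod form C * q)"
    unfolding q[symmetric] sum_d[symmetric] field_det_def
    using uv by (intro deg_le_diff deg_le_mult) (auto simp: tangent_fields_def all_fields_def)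
  moreover have "prod form C \<noteq> 0" "q \<noteq> 0" using nz q by auto
  ultimately have "deg_le 0 q" using deg_le_mult_cancel(2)[of "card C" "prod form C" q] by simp
  then obtain c where c: "q = [:[:c:]:]" by (rule deg_le_0E)
  show ?thesis by (rule that[of c]) (use q c nz in auto)
qed

text \<open>The part of total degree \<open>m\<close>, which is the coefficient of \<open>z\<^sup>m\<close> in \<open>graded p\<close>, gets the factor
\<open>z\<close> to the power \<open>d - m\<close>. So homogenizing reverses \<open>graded p\<close> as a polynomial in \<open>z\<close>, and
multiplicativity is that of \<open>reflect_poly\<close>.\<close>

definition homogenize :: "nat \<Rightarrow> 'k::field poly poly \<Rightarrow> 'k poly3" where
  "homogenize d p = (\<Sum>m\<le>d. monom (coeff (graded p) m) (d - m))"

lemma coeff_homogenize: "coeff (homogenize d p) k = (if k \<le> d then coeff (graded p) (d - k) else 0)"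
proof -
  have "coeff (homogenize d p) k = (\<Sum>m\<le>d. if m = d - k \<and> k \<le> d then coeff (graded p) m else 0)"
    unfolding homogenize_def coeff_sum by (intro sum.cong) auto
  then show ?thesis by (auto simp: if_distrib)
qed

lemma homogeneous3_homogenize: "homogeneous3 d (homogenize d p)"
  by (auto simp: homogeneous3_def coeff_homogenize coeff_graded split: if_splits)

lemma homogenize_add: "homogenize d (p + q) = homogenize d p + homogenize d q"
  by (rule poly_eqI) (simp add: coeff_homogenize ring_morphismD[OF ring_morphism_graded])

lemma homogenize_diff: "homogenize d (p - q) = homogenize d p - homogenize d q"
  by (rule poly_eqI) (simp add: coeff_homogenize ring_morphismD[OF ring_morphism_graded])

lemma homogenize_0 [simp]: "homogenize d 0 = 0"
  by (rule poly_eqI) (simp add: coeff_homogenize ring_morphismD(1)[OF ring_morphism_graded])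

lemma homogenize_const: "homogenize 0 [:[:c:]:] = const3 c"
  by (simp add: homogenize_def monom_0 const3_def)
    (simp add: poly_eq_iff coeff_graded coeff_pCons split: nat.splits)

lemma homogenize_reflect:
  assumes "deg_le d p"
  shows "homogenize d p = monom 1 (d - degree (graded p)) * reflect_poly (graded p)"
proof (rule poly_eqI)
  fix k
  have "degree (graded p) \<le> d" using assms by (simp add: deg_le_iff_graded)
  then show "coeff (homogenize d p) k = coeff (monom 1 (d - degree (graded p)) * reflect_poly (graded p)) k"
    by (auto simp: coeff_homogenize coeff_monom_mult coeff_reflect_poly coeff_eq_0 intro: arg_cong)
qed

lemma homogenize_mult:
  assumes "deg_le d p" "deg_le e q"
  shows "homogenize (d + e) (p * q) = homogenize d p * homogenize e q"
proof (cases "p = 0 \<or> q = 0")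
  case False
  have le: "degree (graded p) \<le> d" "degree (graded q) \<le> e"
    using assms by (simp_all add: deg_le_iff_graded)
  have "homogenize (d + e) (p * q) =
      monom 1 (d + e - (degree (graded p) + degree (graded q))) * reflect_poly (graded (p * q))"
    using False homogenize_reflect[OF deg_le_mult[OF assms]] by (simp add: degree_graded_mult)
  also have "d + e - (degree (graded p) + degree (graded q))
      = (d - degree (graded p)) + (e - degree (graded q))"
    using le by simp
  finally have "homogenize (d + e) (p * q) =
      (monom 1 (d - degree (graded p)) * monom 1 (e - degree (graded q))) *
      (reflect_poly (graded p) * reflect_poly (graded q))"
    by (simp add: ring_morphismD(4)[OF ring_morphism_graded] reflect_poly_mult mult_monom)
  then show ?thesis
    by (simp add: homogenize_reflect assms ac_simps)
qed auto

lemma homogenize_smult: 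
  assumes "deg_le d p"
  shows "homogenize d (smult [:c:] p) = const3 c * homogenize d p"
  using homogenize_mult[of 0 "[:[:c:]:]" d p] assms by (simp add: homogenize_const)

lemma homogenize_lin: "homogenize 1 (lin a b c) = cone_form a b c"
proof -
  have "coeff (coeff (coeff (homogenize 1 (lin a b c)) k) j) i = coeff (coeff (coeff (cone_form a b c) k) j) i"
    for i j k
    by (auto simp: coeff_homogenize coeff_graded lin_def cone_form_def const3_def var_x_def var_y_def
        var_z_def coeff_pCons split: nat.splits)
  then show ?thesis by (simp add: poly_eq_iff)
qed

lemma homogenize_prod:
  "finite B \<Longrightarrow> (\<And>x. x \<in> B \<Longrightarrow> deg_le 1 (f x)) \<Longrightarrow>
    homogenize (card B) (prod f B) = (\<Prod>x\<in>B. homogenize 1 (f x))"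
proof (induction B rule: finite_induct)
  case empty
  show ?case using homogenize_const[of 1] by (simp add: one_pCons const3_def)
next
  case (insert x B)
  then show ?case using homogenize_mult[of 1 "f x" "card B" "prod f B"] deg_le_prod[of B f] by simp
qed

lemma homogenize_dvd:
  assumes "deg_le d p" "lin a b c dvd p" "a \<noteq> 0 \<or> b \<noteq> 0"
  shows "cone_form a b c dvd homogenize d p"
proof -
  obtain q where q: "p = lin a b c * q" using assms(2) by (auto simp: dvd_def)
  show ?thesis
  proof (cases "q = 0")
    case False
    have "lin a b c \<noteq> 0" using assms(3) by (auto simp: lin_def)
    then have "1 \<le> d" "deg_le (d - 1) q"
      using deg_le_mult_cancel[of d "lin a b c" q] assms False by (auto simp: q degree_graded_lin)
    then have "homogenize d p = cone_form a b c * homogenize (d - 1) q"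
      using homogenize_mult[OF deg_le_lin[of a b c], of "d - 1" q]
      unfolding homogenize_lin q by simp
    then show ?thesis by simp
  qed (simp add: q)
qed

lemma cone_form_const3: "cone_form (l * a) (l * b) (l * c) = const3 l * cone_form a b c"
  by (simp add: cone_form_def ring_morphismD[OF ring_morphism_const3] algebra_simps)

lemma poly_cone_form_1: "poly (cone_form a b c) 1 = lin a b c"
  by (simp add: cone_form_def const3_def var_x_def var_y_def var_z_def lin_def one_pCons)

text \<open>If \<open>c = 0\<close>, the form comes from the prime element \<open>a x + b y\<close> of \<open>K[x][y]\<close>. Otherwise it is
associated to \<open>z - s\<close> with \<open>s\<close> in \<open>K[x][y]\<close>, and divisibility by it is vanishing at \<open>z = s\<close>.\<close>

lemma prime_cone_form:
  assumes "a \<noteq> 0 \<or> b \<noteq> 0"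
  shows "prime_elem (cone_form a b c)"
proof (cases "c = 0")
  case True
  have "prime_elem (lin a b 0)" by (rule prime_lin[OF assms, of 0 0]) simp
  moreover have "cone_form a b c = [:lin a b 0:]"
    by (simp add: True cone_form_def const3_def var_x_def var_y_def var_z_def lin_def)
  ultimately show ?thesis by (simp add: lift_prime_elem_poly)
next
  case False
  define s where "s = - smult [:1 / c:] (lin a b 0)"
  have e: "cone_form a b c = [:- s, 1:] * const3 c" "[:- s, 1:] = cone_form a b c * const3 (1 / c)"
    using False by (simp_all add: s_def cone_form_def const3_def var_x_def var_y_def var_z_def lin_def one_pCons)
  have dvd: "cone_form a b c dvd p \<longleftrightarrow> poly p s = 0" for p
  proof -
    have "[:- s, 1:] dvd cone_form a b c" unfolding e(1) by (rule dvd_triv_left)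
    moreover have "cone_form a b c dvd [:- s, 1:]" unfolding e(2) by (rule dvd_triv_left)
    ultimately show ?thesis unfolding poly_eq_0_iff_dvd by (blast intro: dvd_trans)
  qed
  show ?thesis
  proof (rule prime_elemI)
    show "cone_form a b c \<noteq> 0" using e(2) by auto
    show "\<not> cone_form a b c dvd 1" by (simp add: dvd)
    show "cone_form a b c dvd p \<or> cone_form a b c dvd q" if "cone_form a b c dvd p * q" for p q
      using that by (simp add: dvd)
  qed
qed

definition cone :: "('k::field ^ 2) set \<Rightarrow> 'k poly3" where
  "cone H = cone_form (coeff_a H) (coeff_b H) (coeff_c H)"

lemma homogenize_form: "homogenize 1 (form H) = cone H"
  unfolding form_def cone_def by (rule homogenize_lin)

lemma prime_cone: "H \<in> affine_lines \<Longrightarrow> prime_elem (cone H)"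
  unfolding cone_def by (intro prime_cone_form frame_props)

lemma cone_dvd_cone_iff:
  assumes "H \<in> affine_lines" "H' \<in> affine_lines"
  shows "cone H dvd cone H' \<longleftrightarrow> H = H'"
proof
  assume "cone H dvd cone H'"
  then obtain q where "cone H' = cone H * q" by (auto simp: dvd_def)
  then have "poly (cone H') 1 = poly (cone H) 1 * poly q 1" by simp
  then have "form H dvd form H'" by (simp add: cone_def form_def poly_cone_form_1)
  then show "H = H'" using form_dvd_form_iff assms by blast
qed simp

text \<open>Two points of the line, the base point and its translate by the direction, determine the equation up to a factor.\<close>

lemma defining_form_unique:
  fixes a b c :: "'k::field"
  assumes "a \<noteq> 0 \<or> b \<noteq> 0" and H: "line_zero_set a b c \<in> affine_lines" "H = line_zero_set a b c"
  obtains l where "l \<noteq> 0" "cone_form a b c = const3 l * cone H"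
proof -
  note f = frame_props[OF H(1), folded H(2)]
  define p q :: "'k ^ 2" where "p = vector [base_x H, base_y H]"
    "q = vector [base_x H + coeff_b H, base_y H - coeff_a H]"
  have "p \<in> H" "q \<in> H"
    using f(3) H by (simp_all add: on_line_iff p_q_def algebra_simps)
  then have pq: "a * base_x H + b * base_y H + c = 0"
    "a * (base_x H + coeff_b H) + b * (base_y H - coeff_a H) + c = 0"
    using H(2) by (simp_all add: line_zero_set_def p_q_def)
  then have "a * coeff_b H = b * coeff_a H" by algebra
  from proportional_pairs[OF f(1) this]
  obtain l where l: "a = l * coeff_a H" "b = l * coeff_b H" by blast
  have "c = l * coeff_c H" using pq(1) f(3) unfolding l by algebra
  then have "cone_form a b c = const3 l * cone H"
    unfolding cone_def by (simp add: l cone_form_const3)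
  moreover have "l \<noteq> 0" using assms(1) l by auto
  ultimately show ?thesis using that by blast
qed

section \<open>Derivations of the cone\<close>

lemma derivationD:
  assumes "\<theta> \<in> derivations"
  shows "\<theta> (p + q) = \<theta> p + \<theta> q" "\<theta> (const3 c * p) = const3 c * \<theta> p"
    "\<theta> (p * q) = \<theta> p * q + p * \<theta> q" "\<theta> 0 = 0" "\<theta> (const3 c) = 0"
proof -
  show d: "\<theta> (p + q) = \<theta> p + \<theta> q" "\<theta> (const3 c * p) = const3 c * \<theta> p"
    "\<theta> (p * q) = \<theta> p * q + p * \<theta> q" for p q c
    using assms by (auto simp: derivations_def)
  show "\<theta> 0 = 0" using d(1)[of 0 0] by (metis add.right_neutral add_left_cancel)
  have "\<theta> 1 = 0" using d(3)[of 1 1] by (metis add.right_neutral add_left_cancel mult_1 mult_1_right)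
  then show "\<theta> (const3 c) = 0" using d(2)[of c 1] by simp
qed

lemma derivation_ext:
  assumes "\<theta> \<in> derivations" "\<eta> \<in> derivations"
    and "\<theta> var_x = \<eta> var_x" "\<theta> var_y = \<eta> var_y" "\<theta> var_z = \<eta> var_z"
  shows "\<theta> = \<eta>"
proof
  note d = derivationD[OF assms(1)] derivationD[OF assms(2)]
  have 1: "\<theta> [:[:q:]:] = \<eta> [:[:q:]:]" for q
  proof (induction q)
    case (pCons c q)
    have "[:[:pCons c q:]:] = const3 c + var_x * [:[:q:]:]" by (simp add: const3_def var_x_def)
    then show ?case by (simp only: d assms(3) pCons)
  qed (simp add: d)
  have 2: "\<theta> [:q:] = \<eta> [:q:]" for q
  proof (induction q)
    case (pCons c q)
    have "[:pCons c q:] = [:[:c:]:] + var_y * [:q:]" by (simp add: var_y_def)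
    then show ?case by (simp only: d assms(4) pCons 1)
  qed (simp add: d)
  fix p show "\<theta> p = \<eta> p"
  proof (induction p)
    case (pCons c q)
    have "pCons c q = [:c:] + var_z * q" by (simp add: var_z_def)
    then show ?case by (simp only: d assms(5) pCons 2)
  qed (simp add: d)
qed

text \<open>Applying a derivation of the coefficient ring coefficientwise is again a derivation. This covers the
partial derivatives by the inner variables of \<open>K[x][y][z]\<close>.\<close>

lemma map_poly_Leibniz:
  fixes D :: "'a::comm_ring_1 \<Rightarrow> 'a"
  assumes "\<And>a b. D (a + b) = D a + D b" "\<And>a b. D (a * b) = D a * b + a * D b"
  shows "map_poly D (p * q) = map_poly D p * q + p * map_poly D q"
proof -
  have D0: "D 0 = 0" using assms(1)[of 0 0] by (metis add.right_neutral add_left_cancel)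
  have add: "map_poly D (p + q) = map_poly D p + map_poly D q" for p q
    by (intro map_poly_add_additive D0 assms)
  have smult: "map_poly D (smult a p) = smult (D a) p + smult a (map_poly D p)" for a p
    by (intro poly_eqI) (simp add: coeff_map_poly D0 assms)
  show ?thesis
    by (induction p) (simp_all add: add smult D0 map_poly_pCons algebra_simps)
qed

lemma derivationI:
  assumes "\<And>p q. \<theta> (p + q) = \<theta> p + \<theta> q" "\<And>p q. \<theta> (p * q) = \<theta> p * q + p * \<theta> q"
    "\<And>c. \<theta> (const3 c) = 0"
  shows "\<theta> \<in> derivations"
  using assms by (simp add: derivations_def)

lemma partial_derivations: "partial_x \<in> derivations" "partial_y \<in> derivations" "partial_z \<in> derivations"
proof -
  show "partial_x \<in> derivations"
    unfolding partial_x_def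
    by (intro derivationI map_poly_add_additive map_poly_Leibniz)
      (simp_all add: pderiv_add pderiv_mult const3_def map_poly_pCons algebra_simps)
  show "partial_y \<in> derivations"
    unfolding partial_y_def
    by (intro derivationI map_poly_add_additive map_poly_Leibniz)
      (simp_all add: pderiv_add pderiv_mult const3_def map_poly_pCons algebra_simps)
  show "partial_z \<in> derivations"
    unfolding partial_z_def
    by (intro derivationI) (simp_all add: pderiv_add pderiv_mult const3_def algebra_simps)
qed

lemma partial_vars [simp]:
  "partial_x var_x = 1" "partial_x var_y = 0" "partial_x var_z = 0"
  "partial_y var_x = 0" "partial_y var_y = 1" "partial_y var_z = 0"
  "partial_z var_x = 0" "partial_z var_y = 0" "partial_z var_z = 1"
  by (simp_all add: partial_x_def partial_y_def partial_z_def var_x_def var_y_def var_z_def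
      map_poly_pCons pderiv_pCons one_pCons)

lemma subspace_derivations: "der.subspace derivations"
  by (auto simp: der.subspace_def derivations_def der_scale_def algebra_simps)

lemma derivation_cone_form:
  assumes "\<theta> \<in> derivations"
  shows "\<theta> (cone_form a b c) = const3 a * \<theta> var_x + const3 b * \<theta> var_y + const3 c * \<theta> var_z"
  by (simp add: cone_form_def derivationD[OF assms])

lemma subspace_log_derivations: "der.subspace (log_derivations C)"
  unfolding log_derivations_def
  using der.subspace_add[OF subspace_derivations] der.subspace_scale[OF subspace_derivations]
    der.subspace_0[OF subspace_derivations]
  by (auto simp: der.subspace_def) (auto simp: der_scale_def)

text \<open>One equation per line suffices, since any other one is a constant multiple.\<close>

lemma log_derivations_iff:
  fixes C :: "('k::field ^ 2) set set"
  assumes C: "C \<subseteq> affine_lines"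
  shows "\<theta> \<in> log_derivations C \<longleftrightarrow>
    \<theta> \<in> derivations \<and> (\<forall>H\<in>C. cone H dvd \<theta> (cone H)) \<and> var_z dvd \<theta> var_z"
proof -
  have "cone H dvd \<theta> (cone H)" if "\<theta> \<in> log_derivations C" "H \<in> C" for H
    using that C frame_props(1,2)[of H] by (auto simp: log_derivations_def cone_def)
  moreover have "cone_form a b c dvd \<theta> (cone_form a b c)"
    if "\<theta> \<in> derivations" "\<forall>H\<in>C. cone H dvd \<theta> (cone H)" "a \<noteq> 0 \<or> b \<noteq> 0" "line_zero_set a b c \<in> C" for a b c
  proof -
    have "line_zero_set a b c \<in> affine_lines" using that(4) C by blast
    from defining_form_unique[OF that(3) this refl]
    obtain l where l: "cone_form a b c = const3 l * cone (line_zero_set a b c)" by blast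
    have "cone (line_zero_set a b c) dvd \<theta> (cone (line_zero_set a b c))" using that by blast
    then show ?thesis
      unfolding l derivationD(2)[OF that(1)] by (rule mult_dvd_mono[OF dvd_refl])
  qed
  ultimately show ?thesis by (auto simp: log_derivations_def)
qed

definition planar_derivation :: "'k::field poly3 \<times> 'k poly3 \<Rightarrow> 'k poly3 \<Rightarrow> 'k poly3" where
  "planar_derivation w = der_scale (fst w) partial_x + der_scale (snd w) partial_y"

lemma planar_derivation_in: "planar_derivation w \<in> derivations"
  unfolding planar_derivation_def
  by (intro der.subspace_add[OF subspace_derivations] der.subspace_scale[OF subspace_derivations]
      partial_derivations)

lemma planar_derivation_vars [simp]:
  "planar_derivation w var_x = fst w" "planar_derivation w var_y = snd w"
  "planar_derivation w var_z = 0"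
  by (simp_all add: planar_derivation_def der_scale_def)

lemma euler_derivation_in: "euler_derivation \<in> derivations"
  unfolding euler_derivation_def
  by (intro der.subspace_add[OF subspace_derivations] der.subspace_scale[OF subspace_derivations]
      partial_derivations)

lemma euler_derivation_vars [simp]:
  "euler_derivation var_x = var_x" "euler_derivation var_y = var_y" "euler_derivation var_z = var_z"
  by (simp_all add: euler_derivation_def der_scale_def)

lemma euler_in_log_derivations: "C \<subseteq> affine_lines \<Longrightarrow> euler_derivation \<in> log_derivations C"
  by (simp add: log_derivations_iff euler_derivation_in cone_def derivation_cone_form)
    (simp add: cone_form_def)

lemma homogenized_field_in_log:
  fixes C :: "('k::field ^ 2) set set"
  assumes C: "C \<subseteq> affine_lines" and v: "v \<in> tangent_fields C d"
  shows "planar_derivation (homogenize d (fst v), homogenize d (snd v)) \<in> log_derivations C"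
proof -
  have "cone H dvd planar_derivation (homogenize d (fst v), homogenize d (snd v)) (cone H)"
    if "H \<in> C" for H
  proof -
    have H: "H \<in> affine_lines" "form H dvd normal H v" using that C v by (auto simp: tangent_fields_def)
    have d: "deg_le d (fst v)" "deg_le d (snd v)" "deg_le d (normal H v)"
      using v deg_le_normal[of v d H] by (auto simp: tangent_fields_def all_fields_def)
    have "homogenize d (normal H v) = const3 (coeff_a H) * homogenize d (fst v)
        + const3 (coeff_b H) * homogenize d (snd v)"
      using d by (simp add: normal_def homogenize_add homogenize_smult)
    moreover have "cone H dvd homogenize d (normal H v)"
      unfolding cone_def using H d by (intro homogenize_dvd frame_props) (simp_all add: form_def)
    ultimately show ?thesis
      unfolding cone_def by (simp add: derivation_cone_form planar_derivation_in)
  qed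
  then show ?thesis by (simp add: log_derivations_iff[OF C] planar_derivation_in)
qed

text \<open>The homogeneous counterpart of \<open>prod_forms_dvd_det\<close>, for derivations that annihilate \<open>z\<close>. It
is stated for inhomogeneous derivations too, so that the spanning property can be shown for all
elements of \<open>D(cC)\<close> at once.\<close>

lemma prod_cones_dvd_det:
  fixes C :: "('k::field ^ 2) set set"
  assumes C: "line_arrangement C" and "\<theta> \<in> log_derivations C" "\<eta> \<in> log_derivations C"
    and z: "\<theta> var_z = 0" "\<eta> var_z = 0"
  shows "prod cone C dvd \<theta> var_x * \<eta> var_y - \<theta> var_y * \<eta> var_x"
proof (rule prod_dvd_of_prime_dvd)
  show "finite C" using C by (simp add: line_arrangement_def)
  show "prime_elem (cone H)" if "H \<in> C" for H using that C prime_cone by (auto simp: line_arrangement_def)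
  show "\<not> cone H dvd cone H'" if "H \<in> C" "H' \<in> C" "H \<noteq> H'" for H H'
    using that C by (subst cone_dvd_cone_iff) (auto simp: line_arrangement_def)
  fix H assume "H \<in> C"
  then have H: "H \<in> affine_lines" "cone H dvd \<theta> (cone H)" "cone H dvd \<eta> (cone H)"
    using assms by (auto simp: log_derivations_iff line_arrangement_def)
  have der: "\<theta> \<in> derivations" "\<eta> \<in> derivations" using assms by (auto simp: log_derivations_def)
  define a b r s where "a = const3 (coeff_a H)" "b = const3 (coeff_b H)"
    "r = const3 (dual_r H)" "s = const3 (dual_s H)"
  note abrs = this
  have "a * s - b * r = 1"
    unfolding abrs using frame_props(4)[OF H(1)]
    by (metis ring_morphismD(2,4,6)[OF ring_morphism_const3])
  then have "f * g' - g * f' = (a * f + b * g) * (r * f' + s * g') - (r * f + s * g) * (a * f' + b * g')"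
    for f g f' g' by algebra
  moreover have "\<theta> (cone H) = a * \<theta> var_x + b * \<theta> var_y" "\<eta> (cone H) = a * \<eta> var_x + b * \<eta> var_y"
    using z by (simp_all add: cone_def derivation_cone_form der abrs)
  ultimately have "\<theta> var_x * \<eta> var_y - \<theta> var_y * \<eta> var_x
      = \<theta> (cone H) * (r * \<eta> var_x + s * \<eta> var_y) - (r * \<theta> var_x + s * \<theta> var_y) * \<eta> (cone H)"
    by presburger
  then show "cone H dvd \<theta> var_x * \<eta> var_y - \<theta> var_y * \<eta> var_x"
    using H(2,3) by (simp only: dvd_diff dvd_mult dvd_mult2)
qed

text \<open>Saito's criterion. Let \<open>\<theta>1\<close>, \<open>\<theta>2\<close> be the homogenized fields; their determinant is a nonzero constant
times the product of the equations of the cone. After subtracting a multiple of the Euler derivation, an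
element \<open>\<eta>\<close> of \<open>D(cC)\<close> annihilates \<open>z\<close>, and Cramer's rule expresses \<open>\<eta>\<close> through \<open>\<theta>1\<close> and
\<open>\<theta>2\<close>. The numerators are determinants of logarithmic derivations, so the division by the product
of the equations is exact.\<close>

lemma free_of_tangent_basis:
  fixes C :: "('k::field ^ 2) set set"
  assumes C: "line_arrangement C" and u: "u \<in> tangent_fields C d1" and v: "v \<in> tangent_fields C d2"
    and sum_d: "d1 + d2 = card C" and nz: "field_det u v \<noteq> 0"
  shows "free_with_exponents C d1 d2"
proof -
  define F1 G1 F2 G2 where FG: "F1 = homogenize d1 (fst u)" "G1 = homogenize d1 (snd u)"
    "F2 = homogenize d2 (fst v)" "G2 = homogenize d2 (snd v)"
  define \<theta>1 \<theta>2 where th: "\<theta>1 = planar_derivation (F1, G1)" "\<theta>2 = planar_derivation (F2, G2)"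
  let ?E = "euler_derivation :: 'k poly3 \<Rightarrow> 'k poly3"
  have lines: "C \<subseteq> affine_lines" and fin: "finite C" using C by (auto simp: line_arrangement_def)
  obtain c where c: "c \<noteq> 0" "field_det u v = smult [:c:] (prod form C)"
    using det_eq_const_prod_forms[OF C u v sum_d nz] .
  have du: "deg_le d1 (fst u)" "deg_le d1 (snd u)" "deg_le d2 (fst v)" "deg_le d2 (snd v)"
    using u v by (auto simp: tangent_fields_def all_fields_def)
  have degform: "deg_le 1 (form H)" for H by (simp add: form_def deg_le_lin[unfolded One_nat_def])
  have "F1 * G2 - G1 * F2 = homogenize (d1 + d2) (field_det u v)"
    by (simp add: FG field_det_def homogenize_diff homogenize_mult du)
  also have "\<dots> = const3 c * prod cone C"
    unfolding c(2) sum_d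
    unfolding homogenize_smult[OF deg_le_prod[of C form, OF fin degform]]
      homogenize_prod[of C form, OF fin degform] homogenize_form ..
  finally have det: "F1 * G2 - G1 * F2 = const3 c * prod cone C" .
  have c1: "const3 (1 / c) * const3 c = 1"
    using c(1) by (simp add: const3_def one_pCons)
  have det_nz: "F1 * G2 - G1 * F2 \<noteq> 0"
  proof -
    have "const3 c \<noteq> 0" using c1 by auto
    moreover have "prod cone C \<noteq> 0"
      using fin lines prime_cone by (auto simp: prime_elem_def)
    ultimately show ?thesis by (simp add: det)
  qed
  have vars: "\<theta>1 var_x = F1" "\<theta>1 var_y = G1" "\<theta>1 var_z = 0" "\<theta>2 var_x = F2" "\<theta>2 var_y = G2" "\<theta>2 var_z = 0"
    by (simp_all add: th)
  have log: "\<theta>1 \<in> log_derivations C" "\<theta>2 \<in> log_derivations C" "?E \<in> log_derivations C"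
    using homogenized_field_in_log[OF lines u] homogenized_field_in_log[OF lines v]
      euler_in_log_derivations[OF lines] by (simp_all add: th FG)
  have z: "(var_z :: 'k poly3) \<noteq> 0" by (simp add: var_z_def)
  have ne: "?E \<noteq> \<theta>1" "?E \<noteq> \<theta>2" "\<theta>1 \<noteq> \<theta>2"
  proof -
    show "?E \<noteq> \<theta>1" "?E \<noteq> \<theta>2" using vars z by (metis euler_derivation_vars(3))+
    show "\<theta>1 \<noteq> \<theta>2" using det_nz vars by (auto simp: mult.commute)
  qed
  have indep: "der.independent {?E, \<theta>1, \<theta>2}"
  proof
    assume "der.dependent {?E, \<theta>1, \<theta>2}"
    then obtain \<alpha> where \<alpha>: "\<exists>w\<in>{?E, \<theta>1, \<theta>2}. \<alpha> w \<noteq> 0"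
      "(\<Sum>w\<in>{?E, \<theta>1, \<theta>2}. der_scale (\<alpha> w) w) = 0"
      by (subst (asm) der.dependent_finite) auto
    then have "der_scale (\<alpha> ?E) ?E + (der_scale (\<alpha> \<theta>1) \<theta>1 + der_scale (\<alpha> \<theta>2) \<theta>2) = 0"
      using ne by simp
    then have "\<alpha> ?E * ?E p + (\<alpha> \<theta>1 * \<theta>1 p + \<alpha> \<theta>2 * \<theta>2 p) = 0" for p
      by (simp add: fun_eq_iff der_scale_def)
    from this[of var_x] this[of var_y] this[of var_z]
    have eqs: "\<alpha> ?E = 0" "\<alpha> \<theta>1 * F1 + \<alpha> \<theta>2 * F2 = 0" "\<alpha> \<theta>1 * G1 + \<alpha> \<theta>2 * G2 = 0"
      using z by (simp_all add: vars)
    have "\<alpha> \<theta>1 * (F1 * G2 - G1 * F2) = 0" "\<alpha> \<theta>2 * (F1 * G2 - G1 * F2) = 0"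
      using eqs(2,3) by algebra+
    then show False using \<alpha>(1) eqs(1) det_nz by simp
  qed
  have "log_derivations C \<subseteq> der.span {?E, \<theta>1, \<theta>2}"
  proof
    fix \<theta> assume \<theta>: "\<theta> \<in> log_derivations C"
    then obtain h where h: "\<theta> var_z = var_z * h" by (auto simp: log_derivations_def dvd_def)
    define \<eta> where "\<eta> = \<theta> - der_scale h ?E"
    have \<eta>: "\<eta> \<in> log_derivations C"
      unfolding \<eta>_def using \<theta> log(3)
      by (intro der.subspace_diff[OF subspace_log_derivations] der.subspace_scale[OF subspace_log_derivations])
    have \<eta>z: "\<eta> var_z = 0" by (simp add: \<eta>_def der_scale_def h)
    obtain m1 where m1: "\<eta> var_x * G2 - \<eta> var_y * F2 = prod cone C * m1"
      using prod_cones_dvd_det[OF C \<eta> log(2) \<eta>z vars(6)] by (auto simp: dvd_def vars)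
    obtain m2 where m2: "F1 * \<eta> var_y - G1 * \<eta> var_x = prod cone C * m2"
      using prod_cones_dvd_det[OF C log(1) \<eta> vars(3) \<eta>z] by (auto simp: dvd_def vars)
    define k where "k = const3 (1 / c)"
    have P: "prod cone C \<noteq> 0" using det_nz det by auto
    have "prod cone C * (const3 c * \<eta> var_x) = prod cone C * (F1 * m1 + F2 * m2)"
      "prod cone C * (const3 c * \<eta> var_y) = prod cone C * (G1 * m1 + G2 * m2)"
      using det m1 m2 by algebra+
    then have "const3 c * \<eta> var_x = F1 * m1 + F2 * m2" "const3 c * \<eta> var_y = G1 * m1 + G2 * m2"
      using P by simp_all
    then have xy: "\<eta> var_x = (k * m1) * F1 + (k * m2) * F2" "\<eta> var_y = (k * m1) * G1 + (k * m2) * G2"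
      using c1 unfolding k_def[symmetric] by algebra+
    have "\<eta> = der_scale (k * m1) \<theta>1 + der_scale (k * m2) \<theta>2"
    proof (rule derivation_ext)
      show "\<eta> \<in> derivations" using \<eta> by (simp add: log_derivations_def)
      show "der_scale (k * m1) \<theta>1 + der_scale (k * m2) \<theta>2 \<in> derivations"
        unfolding th by (intro der.subspace_add[OF subspace_derivations]
            der.subspace_scale[OF subspace_derivations] planar_derivation_in)
    qed (simp_all add: xy \<eta>z vars der_scale_def)
    then have "\<theta> = der_scale h ?E + (der_scale (k * m1) \<theta>1 + der_scale (k * m2) \<theta>2)"
      unfolding \<eta>_def by (simp add: algebra_simps)
    also have "\<dots> \<in> der.span {?E, \<theta>1, \<theta>2}"
      by (intro der.span_add der.span_scale der.span_base) auto
    finally show "\<theta> \<in> der.span {?E, \<theta>1, \<theta>2}" .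
  qed
  moreover have "der.span {?E, \<theta>1, \<theta>2} \<subseteq> log_derivations C"
    using log by (intro der.span_minimal subspace_log_derivations) auto
  moreover have "homogeneous_derivation d1 \<theta>1" "homogeneous_derivation d2 \<theta>2"
    unfolding homogeneous_derivation_def vars
    by (auto simp: th planar_derivation_in FG homogeneous3_homogenize) (auto simp: homogeneous3_def)
  ultimately show ?thesis
    unfolding free_with_exponents_def using ne indep by (intro exI[of _ \<theta>1] exI[of _ \<theta>2]) auto
qed

section \<open>Values of the characteristic polynomial\<close>

text \<open>On \<open>H\<close> the determinant of \<open>u\<close> and \<open>v\<close> is the normal component of \<open>u\<close> times the component of
\<open>v\<close> along \<open>H\<close>, because \<open>v\<close> has no normal component there. Multiplied by the equation of
\<open>H\<close>, the field \<open>u\<close> becomes tangent to \<open>H\<close> at the cost of one degree.\<close>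

lemma (in line_off_arrangement) free_of_excess_eq:
  assumes "excess C = d1 * d2"
  shows "free_with_exponents C d1 d2" "free_with_exponents (insert H C) (Suc d1) d2"
proof -
  obtain u where u: "u \<in> tangent_fields C d1" "restrict_to H (normal H u) \<noteq> 0"
    using ex_transversal_field[OF assms] .
  obtain v where v: "v \<in> tangent_fields (insert H C) d2" "restrict_to H (along H v) \<noteq> 0"
    using ex_along_field[OF assms] .
  have v': "v \<in> tangent_fields C d2" using v by (simp add: tangent_fields_def)
  have "restrict_to H (normal H v) = 0"
    using v(1) by (simp add: tangent_fields_def form_dvd_iff[OF H(1)])
  then have "restrict_to H (field_det u v) \<noteq> 0"
    using u(2) v(2) by (simp add: field_det_normal_along[OF H(1)])
  then have nz: "field_det u v \<noteq> 0" by auto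
  show "free_with_exponents C d1 d2"
    using free_of_tangent_basis[OF C u(1) v' sum_d nz] .
  have "scale_field (form H) u \<in> tangent_fields (insert H C) (Suc d1)"
  proof -
    have d: "deg_le (Suc d1) (form H * p)" if "deg_le d1 p" for p
      using deg_le_mult[OF deg_le_lin that] by (simp add: form_def)
    have "scale_field (form H) u \<in> all_fields (Suc d1)"
      using u(1) by (simp add: tangent_fields_def all_fields_def scale_field_def d)
    then show ?thesis using u(1) by (simp add: tangent_fields_def)
  qed
  moreover have "field_det (scale_field (form H) u) v = form H * field_det u v"
    by (simp add: field_det_def scale_field_def algebra_simps)
  then have "field_det (scale_field (form H) u) v \<noteq> 0"
    using nz form_nonzero[OF H(1)] by simp
  moreover have "Suc d1 + d2 = card (insert H C)" "line_arrangement (insert H C)"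
    using C H sum_d by (simp_all add: line_arrangement_def)
  ultimately show "free_with_exponents (insert H C) (Suc d1) d2"
    using free_of_tangent_basis v(1) by blast
qed

text \<open>Removing \<open>H\<close> from \<open>C\<close> changes neither the points on \<open>H\<close> nor the value of the characteristic
polynomial at their number, which makes the lines inside and outside \<open>C\<close> one case.\<close>

lemma characteristic_poly_at_num_points:
  fixes C :: "('k::field ^ 2) set set"
  assumes C: "line_arrangement C" and H: "H \<in> affine_lines"
  obtains d1 d2 where "line_off_arrangement (C - {H}) H d1 d2"
    "poly (characteristic_poly C) (int (num_points_on_line C H)) = int (excess (C - {H})) - int (d1 * d2)"
proof -
  let ?C = "C - {H}"
  define d2 where "d2 = card (meeting_points ?C H)"
  define d1 where "d1 = card ?C - d2"
  have C': "line_arrangement ?C" "H \<notin> ?C" using C by (auto simp: line_arrangement_def)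
  have le: "d2 \<le> card ?C" unfolding d2_def by (rule card_meeting_le[OF C'(1) H C'(2)])
  have loc: "line_off_arrangement ?C H d1 d2"
    using C' H le by unfold_locales (simp_all add: d1_def d2_def)
  have "meeting_points ?C H = meeting_points C H" by (auto simp: meeting_points_def)
  then have N: "num_points_on_line C H = d2"
    using C num_points_eq_card_meeting[of C H] H by (simp add: d2_def line_arrangement_def)
  have sum_d: "int (card ?C) = int d1 + int d2" using le by (simp add: d1_def)
  have val: "poly (characteristic_poly C) (int d2) = int (excess C) - int (card C) * int d2 + int d2 * int d2"
    by (simp add: characteristic_poly_lines[OF C] algebra_simps)
  have "poly (characteristic_poly C) (int d2) = int (excess ?C) - int (d1 * d2)"
  proof (cases "H \<in> C")
    case True
    then have ins: "insert H ?C = C" by auto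
    have e: "excess C = excess ?C + d2"
      using excess_insert[OF C'(1) H C'(2)] unfolding ins d2_def .
    have "Suc (card ?C) = card C"
      using C True by (intro card_Suc_Diff1) (simp_all add: line_arrangement_def)
    then have n: "int (card C) = int d1 + int d2 + 1" using sum_d by linarith
    show ?thesis
      unfolding val e n by (simp add: algebra_simps)
  next
    case False
    then have eq: "?C = C" by auto
    show ?thesis
      unfolding val using sum_d unfolding eq by (simp add: algebra_simps)
  qed
  with loc N show ?thesis using that by metis
qed

lemma poly_characteristic_nonneg:
  assumes "line_arrangement C" "H \<in> affine_lines"
  shows "poly (characteristic_poly C) (int (num_points_on_line C H)) \<ge> 0"
proof -
  obtain d1 d2 where loc: "line_off_arrangement (C - {H}) H d1 d2"
    and "poly (characteristic_poly C) (int (num_points_on_line C H)) = int (excess (C - {H})) - int (d1 * d2)"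
    using characteristic_poly_at_num_points[OF assms] .
  moreover have "int (d1 * d2) \<le> int (excess (C - {H}))"
    using line_off_arrangement.excess_ge[OF loc] by (simp only: of_nat_le_iff)
  ultimately show ?thesis by simp
qed

lemma free_of_poly_characteristic_zero:
  assumes "line_arrangement C" "H \<in> affine_lines"
    and "poly (characteristic_poly C) (int (num_points_on_line C H)) = 0"
  shows "free_arrangement C"
proof -
  obtain d1 d2 where loc: "line_off_arrangement (C - {H}) H d1 d2"
    and "poly (characteristic_poly C) (int (num_points_on_line C H)) = int (excess (C - {H})) - int (d1 * d2)"
    using characteristic_poly_at_num_points[OF assms(1,2)] .
  then have "int (excess (C - {H})) = int (d1 * d2)" using assms(3) by simp
  then have e: "excess (C - {H}) = d1 * d2" by (simp only: of_nat_eq_iff)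
  have "C = C - {H} \<or> C = insert H (C - {H})" by auto
  then show ?thesis
    using line_off_arrangement.free_of_excess_eq[OF loc e] by (metis free_arrangement_def)
qed

text \<open>The roots \<open>a\<close> and \<open>a + b\<close> have a nonnegative integer sum and product. If they are not real, they are
complex conjugates and have the same norm. If they are real, both are nonnegative, and the polynomial is
negative strictly between them.\<close>

lemma no_value_between_root_norms:
  fixes a b :: complex and N n e :: nat
  assumes sum: "a + (a + b) = of_nat n" and prod: "a * (a + b) = of_nat e"
    and nonneg: "0 \<le> int e - int n * int N + int N * int N"
  shows "\<not> (cmod a < real N \<and> real N < cmod (a + b))"
proof
  assume N: "cmod a < real N \<and> real N < cmod (a + b)"
  define c where "c = a + b"
  have re: "Re c = real n - Re a" and im: "Im c = - Im a"
    using arg_cong[OF sum, of Re] arg_cong[OF sum, of Im] by (simp_all add: c_def)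
  show False
  proof (cases "Im a = 0")
    case True
    then have norms: "cmod a = \<bar>Re a\<bar>" "cmod c = \<bar>Re c\<bar>" using im by (simp_all add: cmod_eq_Re)
    have p: "Re a * Re c = real e"
      using arg_cong[OF prod, of Re] True by (simp add: c_def)
    have pos: "0 \<le> Re a" "0 \<le> Re c"
    proof -
      have "0 \<le> Re a * Re c" "0 \<le> Re a + Re c" using p re by simp_all
      then show "0 \<le> Re a" "0 \<le> Re c" by (auto simp: zero_le_mult_iff)
    qed
    have "(real N - Re a) * (Re c - real N) > 0"
      using N norms pos by (intro mult_pos_pos) (simp_all add: c_def)
    moreover have "(real N - Re a) * (Re c - real N) = - (real e - real n * real N + real N * real N)"
      using p by (simp add: re algebra_simps)
    moreover have "real e - real n * real N + real N * real N
        = real_of_int (int e - int n * int N + int N * int N)" by simp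
    ultimately show False using nonneg by linarith
  next
    case False
    have "Re a * Im c + Im a * Re c = 0"
      using arg_cong[OF prod, of Im] by (simp add: c_def)
    then have "Im a * (Re c - Re a) = 0" by (simp add: im algebra_simps)
    then have "Re c = Re a" using False by simp
    then have "cmod c = cmod a" by (simp add: cmod_def im)
    then show False using N by (simp add: c_def)
  qed
qed

theorem theorem1p1:
  fixes C :: "('k::field ^ 2) set set" and a b :: complex
  assumes "line_arrangement C"
    and "map_poly of_int (characteristic_poly C) = [:- a, 1:] * [:- (a + b), 1:]"
    and "cmod a \<le> cmod (a + b)"
  shows
    "((\<nexists>H. H \<in> C \<and> cmod a < real (num_points_on_line C H)
          \<and> real (num_points_on_line C H) < cmod (a + b)) \<and>
      (\<forall>H\<in>C. poly (characteristic_poly C) (int (num_points_on_line C H)) \<ge> 0)) \<and>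
     ((\<nexists>L. L \<in> affine_lines \<and> L \<notin> C \<and> cmod a < real (num_points_on_line C L)
          \<and> real (num_points_on_line C L) < cmod (a + b)) \<and>
      (\<forall>L\<in>affine_lines. L \<notin> C \<longrightarrow>
         poly (characteristic_poly C) (int (num_points_on_line C L)) \<ge> 0)) \<and>
     (a \<in> \<nat> \<and> b \<in> \<nat> \<longrightarrow>
        ((\<exists>H\<in>affine_lines. of_nat (num_points_on_line C H) = a
            \<or> of_nat (num_points_on_line C H) = a + b) \<longrightarrow> free_arrangement C) \<and>
        ((\<exists>H\<in>affine_lines. poly (characteristic_poly C) (int (num_points_on_line C H)) = 0)
            \<longrightarrow> free_arrangement C))"
proof -
  have lines: "C \<subseteq> affine_lines" using assms(1) by (simp add: line_arrangement_def)
  have "map_poly of_int [:int (excess C), - int (card C), 1:] = [:- a, 1:] * [:- (a + b), 1:]"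
    using assms(2) characteristic_poly_lines[OF assms(1)] by simp
  then have "of_nat (excess C) = a * (a + b)" "- of_nat (card C) = - a - (a + b)"
    by (simp_all add: map_poly_pCons algebra_simps)
  then have roots: "a * (a + b) = of_nat (excess C)" "a + (a + b) = of_nat (card C)"
    by (simp_all add: algebra_simps minus_equation_iff)
  have val: "poly (characteristic_poly C) (int N) = int (excess C) - int (card C) * int N + int N * int N" for N
    by (simp add: characteristic_poly_lines[OF assms(1)] algebra_simps)
  have nonneg: "poly (characteristic_poly C) (int (num_points_on_line C H)) \<ge> 0" if "H \<in> affine_lines" for H
    by (rule poly_characteristic_nonneg[OF assms(1) that])
  have between: "\<not> (cmod a < real (num_points_on_line C H) \<and> real (num_points_on_line C H) < cmod (a + b))"
    if "H \<in> affine_lines" for H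
    using no_value_between_root_norms[OF roots(2,1)] nonneg[OF that] val by simp
  have free: "free_arrangement C"
    if "H \<in> affine_lines" "of_nat (num_points_on_line C H) = a \<or> of_nat (num_points_on_line C H) = a + b" for H
  proof -
    define N where "N = num_points_on_line C H"
    have "(of_int (poly (characteristic_poly C) (int N)) :: complex) = (of_nat N - a) * (of_nat N - (a + b))"
      unfolding val using roots by (simp add: algebra_simps flip: roots)
    also have "\<dots> = 0" using that(2) by (auto simp: N_def)
    finally have "poly (characteristic_poly C) (int N) = 0" by (simp only: of_int_eq_0_iff)
    then show ?thesis
      using free_of_poly_characteristic_zero[OF assms(1) that(1)] by (simp add: N_def)
  qed
  show ?thesis
    using nonneg between free lines free_of_poly_characteristic_zero[OF assms(1)] by blast
qed

end
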